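(* Let $f\in C^3(\mathbb R^n;\mathbb R^n)$ and let $\mathcal T=\{\mathfrak S_\nu\}_\nu$ be a triangulation in $\mathbb R^n$. Assume that, for some constant $\epsilon_0>0$ and some constants $B_\nu$, $B_{3,\nu}$ bounding the second- and third-order derivatives of $f$ on $\mathfrak S_\nu$, the constraints 1--4 of the Verification Problem (see context) are satisfied for some values $P_{ij}(x_k)=P_{ji}(x_k)\in\mathbb R$ ($x_k\in\mathcal V_{\mathcal T}$, $1\le i,j\le n$), $C_\nu\ge 0$, $D_\nu\ge 0$ ($\mathfrak S_\nu\in\mathcal T$). Then the matrix-valued function $P$ obtained from the values $P_{ij}(x_k)$ by CPA interpolation on $\mathcal T$ is a Riemannian metric (on $G=\mathcal D_{\mathcal T}^\circ$), and it is contracting in any compact set $K\subset\mathcal D_{\mathcal T}^\circ$ (i.e. for every compact $K\subset\mathcal D_{\mathcal T}^\circ$ there is $\nu_K>0$ such that $P$ is contracting in $K$ with exponent $-\nu_K$).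
   Context: Consider the ODE $\dot x=f(x)$ on $\mathbb R^n$; the solution with $x(0)=\xi$ is denoted $S_t\xi$ and is assumed to exist for all $t\ge0$. $\mathbb S^{n\times n}$ denotes the real symmetric $n\times n$ matrices, $A\preceq B$ means that $A-B$ is negative semidefinite, $Df$ is the Jacobian matrix of $f$, and $A^\circ$ denotes the interior of a set $A$. **Riemannian metric.** For $G\subset\mathbb R^n$ open, a Riemannian metric is a locally Lipschitz continuous function $M:G\to\mathbb S^{n\times n}$ with $M(x)$ positive definite for all $x\in G$. Its forward orbital derivative is (entrywise) $M'_+(x)=\limsup_{h\to0^+}\frac{M(S_hx)-M(x)}{h}$ (which equals $\limsup_{h\to0^+}\frac{M(x+hf(x))-M(x)}{h}$). **Contracting.** For $K\subset G$ compact, $M$ is contracting in $K$ with exponent $-\nu<0$ if for all $x\in K$ $$\max_{v\in\mathbb R^n,\ v^TM(x)v=1}\ \tfrac12 v^T\big[M(x)Df(x)+Df(x)^TM(x)+M'_+(x)\big]v\ \le\ -\nu .$$ **Triangulation.** An $n$-simplex is the convex hull $\operatorname{co}(x_0,\dots,x_n)$ of affinely independent points of $\mathbb R^n$. A triangulation is a finite set $\mathcal T=\{\mathfrak S_\nu\}_\nu$ of $n$-simplices such that any two different simplices intersect in a common face or not at all. $\mathcal D_{\mathcal T}=\bigcup_\nu\mathfrak S_\nu$ is its domain and $\mathcal V_{\mathcal T}$ is the set of all vertices of its simplices. **CPA interpolation.** Given values $P_{ij}(x_k)$ at the vertices $x_k\in\mathcal V_{\mathcal T}$, $P_{ij}:\mathcal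 D_{\mathcal T}\to\mathbb R$ is the unique continuous function that is affine on each simplex and takes these values at the vertices, i.e. $P_{ij}(\sum_k\lambda_kx_k)=\sum_k\lambda_kP_{ij}(x_k)$ for $\sum_k\lambda_kx_k\in\mathfrak S_\nu=\operatorname{co}(x_0,\dots,x_n)$, $\lambda_k\ge0$, $\sum_k\lambda_k=1$; and $P=(P_{ij})_{i,j=1,\dots,n}$. The (constant) gradient of $P_{ij}$ on $\mathfrak S_\nu$ is denoted $w^\nu_{ij}\in\mathbb R^n$. **Verification Problem.** Constants: $\epsilon_0>0$; $h_\nu=\operatorname{diam}(\mathfrak S_\nu)=\max_{x,y\in\mathfrak S_\nu}\|x-y\|_2$; and $$B_\nu\ge\max_{x\in\mathfrak S_\nu,\ i,j,k}\Big|\frac{\partial^2f_k}{\partial x_i\partial x_j}(x)\Big|,\qquad B_{3,\nu}\ge\max_{x\in\mathfrak S_\nu,\ i,j,k,l}\Big|\frac{\partial^3f_l}{\partial x_i\partial x_j\partial x_k}(x)\Big|.$$ Variables: symmetric matrices $P(x_k)=(P_{ij}(x_k))$ for $x_k\in\mathcal V_{\mathcal T}$; $C_\nu,D_\nu\ge0$ for $\mathfrak S_\nu\in\mathcal T$. Constraints: 1. $P(x_k)\succeq\epsilon_0I$ for each $x_k\in\mathcal V_{\mathcal T}$. 2. $P(x_k)\preceq C_\nu I$ for each simplex $\mathfrak S_\nu$ and each vertex $x_k$ of $\mathfrak S_\nu$. 3. $\|w^\nu_{ij}\|_1\le D_\nu$ for each simplex $\mathfrak S_\nu$ and all $1\le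 i\le j\le n$. 4. For each simplex $\mathfrak S_\nu$ and each vertex $x_k$ of $\mathfrak S_\nu$: $A_\nu(x_k)+h_\nu^2E_\nu I\preceq-\epsilon_0I$, where $$A_\nu(x_k)=P(x_k)Df(x_k)+Df(x_k)^TP(x_k)+\big(w^\nu_{ij}\cdot f(x_k)\big)_{i,j=1,\dots,n},$$ $$E_\nu=n^2(1+4\sqrt n)B_\nu D_\nu+2n^3B_{3,\nu}C_\nu .$$ *)

theory Defs
  imports "HOL-Analysis.Analysis"
begin

section \<open>Symmetric matrices\<close>

definition symmetric_matrix :: "real ^ 'n ^ 'n \<Rightarrow> bool" where
  "symmetric_matrix A \<longleftrightarrow> transpose A = A"

definition positive_definite :: "real ^ 'n ^ 'n \<Rightarrow> bool" where
  "positive_definite A \<longleftrightarrow> (\<forall>v. v \<noteq> 0 \<longrightarrow> v \<bullet> (A *v v) > 0)"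

definition negative_semidefinite :: "real ^ 'n ^ 'n \<Rightarrow> bool" where
  "negative_semidefinite A \<longleftrightarrow> (\<forall>v. v \<bullet> (A *v v) \<le> 0)"

text \<open>The Loewner order; it is only used between symmetric matrices.\<close>

definition loewner_le :: "real ^ 'n ^ 'n \<Rightarrow> real ^ 'n ^ 'n \<Rightarrow> bool"  (infix \<open>\<preceq>\<^sub>L\<close> 50) where
  "A \<preceq>\<^sub>L B \<longleftrightarrow> negative_semidefinite (A - B)"

section \<open>Partial derivatives and smoothness\<close>

definition partial :: "'n \<Rightarrow> (real ^ 'n \<Rightarrow> real) \<Rightarrow> real ^ 'n \<Rightarrow> real" where
  "partial i g x = frechet_derivative g (at x) (axis i 1)"

primrec C_k_scalar :: "nat \<Rightarrow> (real ^ 'n \<Rightarrow> real) \<Rightarrow> bool" where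
  "C_k_scalar 0 g \<longleftrightarrow> continuous_on UNIV g"
| "C_k_scalar (Suc k) g \<longleftrightarrow>
     (\<forall>x. g differentiable (at x)) \<and> (\<forall>i. C_k_scalar k (partial i g))"

definition C_k :: "nat \<Rightarrow> (real ^ 'n \<Rightarrow> real ^ 'm) \<Rightarrow> bool" where
  "C_k k f \<longleftrightarrow> (\<forall>l. C_k_scalar k (\<lambda>x. f x $ l))"

abbreviation Jac :: "(real ^ 'n \<Rightarrow> real ^ 'm) \<Rightarrow> real ^ 'n \<Rightarrow> real ^ 'n ^ 'm" where
  "Jac f x \<equiv> jacobian f (at x)"

section \<open>Solutions of the ODE\<close>

definition forward_flow :: "(real ^ 'n \<Rightarrow> real ^ 'n) \<Rightarrow> (real \<Rightarrow> real ^ 'n \<Rightarrow> real ^ 'n) \<Rightarrow> bool" where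
  "forward_flow f S \<longleftrightarrow>
     (\<forall>\<xi>. S 0 \<xi> = \<xi> \<and>
       (\<forall>t\<ge>0. ((\<lambda>s. S s \<xi>) has_vector_derivative f (S t \<xi>)) (at t within {0..})))"

section \<open>Riemannian metrics and contraction\<close>

definition locally_lipschitz_on ::
  "'a::metric_space set \<Rightarrow> ('a \<Rightarrow> 'b::metric_space) \<Rightarrow> bool" where
  "locally_lipschitz_on G M \<longleftrightarrow> (\<forall>x\<in>G. \<exists>u>0. \<exists>L. L-lipschitz_on (cball x u \<inter> G) M)"

definition riemannian_metric :: "(real ^ 'n) set \<Rightarrow> (real ^ 'n \<Rightarrow> real ^ 'n ^ 'n) \<Rightarrow> bool" where
  "riemannian_metric G M \<longleftrightarrow>
     open G \<and> locally_lipschitz_on G M \<and>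
     (\<forall>x\<in>G. symmetric_matrix (M x) \<and> positive_definite (M x))"

text \<open>
  The limit superior is taken in the extended reals. For a metric that is locally Lipschitz near x
  the difference quotients are bounded for small positive h, so the value is finite and the
  conversion back to the reals loses nothing.
\<close>

definition orbital_derivative ::
  "(real \<Rightarrow> real ^ 'n \<Rightarrow> real ^ 'n) \<Rightarrow> (real ^ 'n \<Rightarrow> real ^ 'n ^ 'n) \<Rightarrow> real ^ 'n \<Rightarrow> real ^ 'n ^ 'n" where
  "orbital_derivative S M x =
     (\<chi> i j. real_of_ereal
        (Limsup (at_right 0) (\<lambda>h. ereal ((M (S h x) $ i $ j - M x $ i $ j) / h))))"

text \<open>
  For positive definite \<open>M x\<close> the supremum ranges over a continuous function on a nonempty
  compact set, so it is the maximum.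
\<close>

definition contracting_in ::
  "(real ^ 'n \<Rightarrow> real ^ 'n) \<Rightarrow> (real \<Rightarrow> real ^ 'n \<Rightarrow> real ^ 'n) \<Rightarrow>
   (real ^ 'n \<Rightarrow> real ^ 'n ^ 'n) \<Rightarrow> (real ^ 'n) set \<Rightarrow> real \<Rightarrow> bool" where
  "contracting_in f S M K \<nu> \<longleftrightarrow>
     (\<forall>x\<in>K.
        (SUP v \<in> {v. v \<bullet> (M x *v v) = 1}.
           1/2 * (v \<bullet> ((M x ** Jac f x + transpose (Jac f x) ** M x
                          + orbital_derivative S M x) *v v)))
        \<le> - \<nu>)"

section \<open>Triangulations and CPA interpolation\<close>

text \<open>The library notion of triangulation allows simplices of mixed dimension.\<close>

definition full_triangulation :: "(real ^ 'n) set set \<Rightarrow> bool" where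
  "full_triangulation \<T> \<longleftrightarrow> triangulation \<T> \<and> (\<forall>\<SS>\<in>\<T>. int CARD('n) simplex \<SS>)"

text \<open>The affinely independent points spanning a simplex are its extreme points.\<close>

definition vertices :: "(real ^ 'n) set \<Rightarrow> (real ^ 'n) set" where
  "vertices \<SS> = {x. x extreme_point_of \<SS>}"

text \<open>
  Outside \<open>\<Union>\<T>\<close> the value is unspecified. On \<open>\<Union>\<T>\<close> the value is unique, because two simplices
  meet in a common face and barycentric coordinates are unique; see \<open>cpa_eq\<close>.
\<close>

definition cpa :: "(real ^ 'n) set set \<Rightarrow> (real ^ 'n \<Rightarrow> real) \<Rightarrow> real ^ 'n \<Rightarrow> real" where
  "cpa \<T> p x =
     (THE y. \<exists>\<SS>\<in>\<T>. \<exists>c. (\<forall>v\<in>vertices \<SS>. c v \<ge> 0) \<and> (\<Sum>v\<in>vertices \<SS>. c v) = 1 \<and>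
        x = (\<Sum>v\<in>vertices \<SS>. c v *\<^sub>R v) \<and> y = (\<Sum>v\<in>vertices \<SS>. c v * p v))"

definition cpa_matrix ::
  "(real ^ 'n) set set \<Rightarrow> (real ^ 'n \<Rightarrow> real ^ 'n ^ 'n) \<Rightarrow> real ^ 'n \<Rightarrow> real ^ 'n ^ 'n" where
  "cpa_matrix \<T> V x = (\<chi> i j. cpa \<T> (\<lambda>v. V v $ i $ j) x)"

text \<open>The constant gradient of a function that is affine on a full-dimensional simplex.\<close>

definition simplex_gradient :: "(real ^ 'n) set \<Rightarrow> (real ^ 'n \<Rightarrow> real) \<Rightarrow> real ^ 'n" where
  "simplex_gradient \<SS> g = (THE w. \<forall>x\<in>interior \<SS>. GDERIV g x :> w)"

definition cpa_gradient ::
  "(real ^ 'n) set set \<Rightarrow> (real ^ 'n \<Rightarrow> real ^ 'n ^ 'n) \<Rightarrow> (real ^ 'n) set \<Rightarrow> 'n \<Rightarrow> 'n \<Rightarrow> real ^ 'n" where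
  "cpa_gradient \<T> V \<SS> i j = simplex_gradient \<SS> (\<lambda>x. cpa_matrix \<T> V x $ i $ j)"

section \<open>The quantities in the constraints\<close>

definition norm1 :: "real ^ 'n \<Rightarrow> real" where
  "norm1 w = (\<Sum>k\<in>UNIV. \<bar>w $ k\<bar>)"

definition A_mat ::
  "(real ^ 'n \<Rightarrow> real ^ 'n) \<Rightarrow> (real ^ 'n) set set \<Rightarrow> (real ^ 'n \<Rightarrow> real ^ 'n ^ 'n) \<Rightarrow>
   (real ^ 'n) set \<Rightarrow> real ^ 'n \<Rightarrow> real ^ 'n ^ 'n" where
  "A_mat f \<T> V \<SS> x =
     V x ** Jac f x + transpose (Jac f x) ** V x + (\<chi> i j. cpa_gradient \<T> V \<SS> i j \<bullet> f x)"

definition E_const :: "nat \<Rightarrow> real \<Rightarrow> real \<Rightarrow> real \<Rightarrow> real \<Rightarrow> real" where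
  "E_const n B B3 C D =
     real n ^ 2 * (1 + 4 * sqrt (real n)) * B * D + 2 * real n ^ 3 * B3 * C"

section \<open>The interpolation is well defined\<close>

lemma vertices_simplex:
  fixes \<SS> :: "(real ^ 'n) set"
  assumes "k simplex \<SS>"
  shows "finite (vertices \<SS>)" "\<not> affine_dependent (vertices \<SS>)"
    "int (card (vertices \<SS>)) = k + 1" "convex hull (vertices \<SS>) = \<SS>"
proof -
  obtain C where C: "\<not> affine_dependent C" "int (card C) = k + 1" "\<SS> = convex hull C"
    using assms unfolding simplex_def by blast
  then have "vertices \<SS> = C"
    unfolding vertices_def using extreme_point_of_convex_hull_affine_independent by blast
  with C show "finite (vertices \<SS>)" "\<not> affine_dependent (vertices \<SS>)"
    "int (card (vertices \<SS>)) = k + 1" "convex hull (vertices \<SS>) = \<SS>"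
    using aff_independent_finite by auto
qed

lemma barycentric_unique:
  fixes C :: "(real ^ 'n) set"
  assumes "finite C" "\<not> affine_dependent C"
    and "sum a C = 1" "sum b C = 1" "(\<Sum>v\<in>C. a v *\<^sub>R v) = (\<Sum>v\<in>C. b v *\<^sub>R v)" "v \<in> C"
  shows "a v = b v"
proof (rule ccontr)
  assume "a v \<noteq> b v"
  then have "\<exists>U. sum U C = 0 \<and> (\<exists>v\<in>C. U v \<noteq> 0) \<and> (\<Sum>v\<in>C. U v *\<^sub>R v) = 0"
    using assms(3-6)
    by (intro exI[of _ "\<lambda>v. a v - b v"]) (auto simp: sum_subtractf scaleR_diff_left)
  then show False
    using affine_dependent_explicit_finite[OF assms(1)] assms(2) by blast
qed

lemma cpa_eq:
  fixes \<T> :: "(real ^ 'n) set set"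
  assumes tri: "full_triangulation \<T>" and S: "\<SS> \<in> \<T>"
    and c: "\<And>v. v \<in> vertices \<SS> \<Longrightarrow> c v \<ge> 0" "(\<Sum>v\<in>vertices \<SS>. c v) = 1"
  shows "cpa \<T> p (\<Sum>v\<in>vertices \<SS>. c v *\<^sub>R v) = (\<Sum>v\<in>vertices \<SS>. c v * p v)"
  unfolding cpa_def
proof (rule the_equality)
  show "\<exists>\<SS>'\<in>\<T>. \<exists>c'. (\<forall>v\<in>vertices \<SS>'. c' v \<ge> 0) \<and> (\<Sum>v\<in>vertices \<SS>'. c' v) = 1 \<and>
      (\<Sum>v\<in>vertices \<SS>. c v *\<^sub>R v) = (\<Sum>v\<in>vertices \<SS>'. c' v *\<^sub>R v) \<and>
      (\<Sum>v\<in>vertices \<SS>. c v * p v) = (\<Sum>v\<in>vertices \<SS>'. c' v * p v)"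
    using S c by blast
next
  fix y
  assume "\<exists>\<SS>'\<in>\<T>. \<exists>c'. (\<forall>v\<in>vertices \<SS>'. c' v \<ge> 0) \<and> (\<Sum>v\<in>vertices \<SS>'. c' v) = 1 \<and>
      (\<Sum>v\<in>vertices \<SS>. c v *\<^sub>R v) = (\<Sum>v\<in>vertices \<SS>'. c' v *\<^sub>R v) \<and>
      y = (\<Sum>v\<in>vertices \<SS>'. c' v * p v)"
  then obtain \<SS>' c' where S': "\<SS>' \<in> \<T>" "\<And>v. v \<in> vertices \<SS>' \<Longrightarrow> c' v \<ge> 0"
      "(\<Sum>v\<in>vertices \<SS>'. c' v) = 1"
      "(\<Sum>v\<in>vertices \<SS>. c v *\<^sub>R v) = (\<Sum>v\<in>vertices \<SS>'. c' v *\<^sub>R v)"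
      "y = (\<Sum>v\<in>vertices \<SS>'. c' v * p v)"
    by blast
  define x where "x = (\<Sum>v\<in>vertices \<SS>. c v *\<^sub>R v)"
  define F where "F = \<SS> \<inter> \<SS>'"
  define C where "C = {v. v extreme_point_of F}"
  have s1: "int CARD('n) simplex \<SS>" and s2: "int CARD('n) simplex \<SS>'"
    using tri S S' unfolding full_triangulation_def by auto
  note v1 = vertices_simplex[OF s1] and v2 = vertices_simplex[OF s2]
  have f: "F face_of \<SS>" "F face_of \<SS>'"
    using tri S S' unfolding full_triangulation_def triangulation_def F_def
    by (blast, metis inf_commute)
  have "x \<in> convex hull (vertices \<SS>)"
    unfolding convex_hull_finite[OF v1(1)] x_def using c by auto
  moreover have "x \<in> convex hull (vertices \<SS>')"
    unfolding convex_hull_finite[OF v2(1)] x_def S'(4) using S' by auto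
  ultimately have xF: "x \<in> F" using v1 v2 F_def by auto
  have "compact F" "convex F"
    unfolding F_def using s1 s2
    by (auto simp: compact_simplex convex_simplex compact_Int convex_Int)
  then have FC: "F = convex hull C"
    unfolding C_def by (rule Krein_Milman_Minkowski)
  have sub: "C \<subseteq> vertices \<SS>" "C \<subseteq> vertices \<SS>'"
    unfolding C_def vertices_def using f extreme_point_of_face by blast+
  have finC: "finite C" using sub v1 finite_subset by blast
  obtain u where u: "sum u C = 1" "(\<Sum>v\<in>C. u v *\<^sub>R v) = x"
    using xF unfolding FC convex_hull_finite[OF finC] by auto
  define w where "w v = (if v \<in> C then u v else 0)" for v
  have ext: "sum w V = 1" "(\<Sum>v\<in>V. w v *\<^sub>R v) = x" "(\<Sum>v\<in>V. w v * p v) = (\<Sum>v\<in>C. u v * p v)"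
    if "C \<subseteq> V" "finite V" for V
  proof -
    have "sum w V = sum w C" "(\<Sum>v\<in>V. w v *\<^sub>R v) = (\<Sum>v\<in>C. w v *\<^sub>R v)"
      "(\<Sum>v\<in>V. w v * p v) = (\<Sum>v\<in>C. w v * p v)"
      by (rule sum.mono_neutral_right; use that in \<open>auto simp: w_def\<close>)+
    moreover have "sum w C = sum u C" "(\<Sum>v\<in>C. w v *\<^sub>R v) = (\<Sum>v\<in>C. u v *\<^sub>R v)"
      "(\<Sum>v\<in>C. w v * p v) = (\<Sum>v\<in>C. u v * p v)"
      by (simp_all add: w_def)
    ultimately show "sum w V = 1" "(\<Sum>v\<in>V. w v *\<^sub>R v) = x"
      "(\<Sum>v\<in>V. w v * p v) = (\<Sum>v\<in>C. u v * p v)"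
      using u by auto
  qed
  have "(\<Sum>v\<in>vertices \<SS>. c v * p v) = (\<Sum>v\<in>vertices \<SS>. w v * p v)"
    using barycentric_unique[OF v1(1,2), of c w] c ext(1,2)[OF sub(1) v1(1)] x_def
    by (intro sum.cong) auto
  moreover have "y = (\<Sum>v\<in>vertices \<SS>'. w v * p v)"
    unfolding S'(5)
    using barycentric_unique[OF v2(1,2), of c' w] S' ext(1,2)[OF sub(2) v2(1)] x_def
    by (intro sum.cong) auto
  ultimately show "y = (\<Sum>v\<in>vertices \<SS>. c v * p v)"
    using ext(3)[OF sub(1) v1(1)] ext(3)[OF sub(2) v2(1)] by simp
qed

end

theory Submission
  imports Defs
begin

text \<open>
  Inside a simplex \<open>P\<close> is affine, so \<open>A(x) = P Df + Df\<^sup>T P + (w\<^sub>i\<^sub>j \<bullet> f)\<close> differs from the barycentric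
  combination of its vertex values only through the interpolation errors of \<open>f\<close> and \<open>Df\<close> and through
  the covariance of \<open>P\<close> and \<open>Df\<close>. Two applications of the mean value theorem bound these errors
  entrywise by \<open>h\<^sup>2 E / n\<close>, hence the form of \<open>A(x)\<close> is at most \<open>-\<epsilon>\<^sub>0 \<parallel>v\<parallel>\<^sup>2\<close>, as at the vertices.
  For small \<open>h > 0\<close> the ray \<open>x + h f(x)\<close> stays in one of the finitely many simplices, and since \<open>P\<close> is
  locally Lipschitz it may replace the trajectory; so all entries of the orbital derivative at \<open>x\<close> are
  \<open>w\<^sub>i\<^sub>j \<bullet> f(x)\<close> for one common simplex containing \<open>x\<close>. With \<open>v\<^sup>T P v = 1\<close> and \<open>P \<le> m I\<close>
  one gets \<open>\<parallel>v\<parallel>\<^sup>2 \<ge> 1/m\<close>, which yields the exponent \<open>-\<epsilon>\<^sub>0 / (2 m)\<close>.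
\<close>

section \<open>Quadratic forms\<close>

lemma norm1_nonneg: "norm1 w \<ge> 0"
  unfolding norm1_def by (simp add: sum_nonneg)

text \<open>Cauchy-Schwarz against the all-ones vector; every \<open>sqrt n\<close> in the error
  bounds originates here.\<close>

lemma norm1_power2_le: "(norm1 w)\<^sup>2 \<le> real CARD('n) * (norm w)\<^sup>2" for w :: "real ^ 'n"
proof -
  have "(norm1 w)\<^sup>2 \<le> (\<Sum>k\<in>UNIV. \<bar>w $ k\<bar>\<^sup>2) * real CARD('n)"
    unfolding norm1_def by (rule sum_squared_le_sum_of_squares)
  also have "(\<Sum>k\<in>UNIV. \<bar>w $ k\<bar>\<^sup>2) = (norm w)\<^sup>2"
    by (simp add: norm_vec_def L2_set_def sum_nonneg)
  finally show ?thesis by (simp add: mult.commute)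
qed

lemma norm1_le: "norm1 w \<le> sqrt (real CARD('n)) * norm w" for w :: "real ^ 'n"
  by (rule power2_le_imp_le) (simp_all add: norm1_power2_le power_mult_distrib)

text \<open>Hoelder's inequality for the exponents 1 and infinity, matching the 1-norm of the
  gradients in constraint 3.\<close>

lemma abs_inner_le_norm1:
  fixes w y :: "real ^ 'n"
  assumes "\<And>k. \<bar>y $ k\<bar> \<le> b"
  shows "\<bar>w \<bullet> y\<bar> \<le> norm1 w * b"
proof -
  have "\<bar>w \<bullet> y\<bar> \<le> (\<Sum>k\<in>UNIV. \<bar>w $ k * y $ k\<bar>)"
    unfolding inner_vec_def by (simp add: sum_abs)
  also have "\<dots> \<le> (\<Sum>k\<in>UNIV. \<bar>w $ k\<bar> * b)"
    by (intro sum_mono) (simp add: abs_mult mult_left_mono assms)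
  finally show ?thesis by (simp add: norm1_def sum_distrib_right)
qed

lemma abs_sum_mult_le_norm1:
  fixes d :: "real ^ 'n"
  assumes "\<And>k. \<bar>a k\<bar> \<le> b"
  shows "\<bar>\<Sum>k\<in>UNIV. d $ k * a k\<bar> \<le> b * norm1 d"
  using abs_inner_le_norm1[of "\<chi> k. a k" b d] assms
  by (simp add: inner_vec_def mult.commute)

lemma mat_mult_vector: "mat k *v v = k *\<^sub>R v" for v :: "real ^ 'n"
  by (simp add: vec_eq_iff mat_def matrix_vector_mult_def if_distrib if_distribR cong: if_cong)

lemma loewner_le_form: "A \<preceq>\<^sub>L B \<Longrightarrow> u \<bullet> (A *v u) \<le> u \<bullet> (B *v u)"
  by (simp add: loewner_le_def negative_semidefinite_def matrix_vector_mult_diff_rdistrib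
      inner_diff_right)

lemma form_mat: "u \<bullet> (mat k *v u) = k * (norm u)\<^sup>2" for u :: "real ^ 'n"
  by (simp add: mat_mult_vector power2_norm_eq_inner)

lemma symmetric_matrix_entry:
  assumes "symmetric_matrix A"
  shows "A $ j $ i = A $ i $ j"
proof -
  have "transpose A $ i $ j = A $ j $ i" by (simp add: transpose_def)
  then show ?thesis using assms by (simp add: symmetric_matrix_def)
qed

text \<open>Hoelder in both indices gives \<open>e * (norm1 v)\<^sup>2\<close>, and Cauchy-Schwarz
  then costs the dimension factor. Entrywise errors thus become bounds on quadratic forms.\<close>

lemma quadratic_form_entrywise_bound:
  fixes A :: "real ^ 'n ^ 'n"
  assumes "\<And>i j. \<bar>A $ i $ j\<bar> \<le> e"
  shows "\<bar>v \<bullet> (A *v v)\<bar> \<le> e * real CARD('n) * (norm v)\<^sup>2"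
proof -
  have e: "e \<ge> 0" using assms abs_ge_zero order_trans by blast
  have "\<bar>v \<bullet> (A *v v)\<bar> \<le> norm1 v * (e * norm1 v)"
  proof (rule abs_inner_le_norm1)
    fix k
    show "\<bar>(A *v v) $ k\<bar> \<le> e * norm1 v"
      unfolding matrix_vector_mult_def
      using abs_sum_mult_le_norm1[of "\<lambda>j. A $ k $ j" e v] assms by (simp add: mult.commute)
  qed
  also have "\<dots> = e * (norm1 v)\<^sup>2" by (simp add: power2_eq_square)
  also have "\<dots> \<le> e * (real CARD('n) * (norm v)\<^sup>2)"
    by (intro mult_left_mono norm1_power2_le e)
  finally show ?thesis by (simp add: mult.assoc)
qed

text \<open>By polarization, four times an entry is the difference of two values of the quadratic form.\<close>

lemma symmetric_entry_bound:
  fixes A :: "real ^ 'n ^ 'n"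
  assumes sym: "symmetric_matrix A"
    and nonneg: "\<And>v. v \<bullet> (A *v v) \<ge> 0"
    and le: "\<And>v. v \<bullet> (A *v v) \<le> c * (norm v)\<^sup>2"
  shows "\<bar>A $ i $ j\<bar> \<le> c"
proof -
  define p m :: "real ^ 'n" where "p = axis i 1 + axis j 1" and "m = axis i 1 - axis j 1"
  have c: "c \<ge> 0"
    using nonneg[of "axis i 1"] le[of "axis i 1"] by simp
  have e: "axis a 1 \<bullet> (A *v axis b 1) = A $ a $ b" for a b
    by (simp add: matrix_vector_mult_basis column_def inner_axis')
  have s: "A $ j $ i = A $ i $ j"
    by (rule symmetric_matrix_entry[OF sym])
  have "p \<bullet> (A *v p) - m \<bullet> (A *v m) = 4 * A $ i $ j"
    unfolding p_def m_def
    by (simp add: matrix_vector_right_distrib matrix_vector_mult_diff_distrib inner_add_left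
        inner_add_right inner_diff_left inner_diff_right e s)
  \<comment> \<open>The bound 2 also covers \<open>i = j\<close>, where \<open>p\<close> is twice a
    basis vector and \<open>m\<close> vanishes.\<close>
  moreover have "norm p \<le> 2" "norm m \<le> 2"
    unfolding p_def m_def by (intro norm_triangle_le norm_triangle_le_diff; simp)+
  then have "(norm p)\<^sup>2 \<le> 2\<^sup>2" "(norm m)\<^sup>2 \<le> 2\<^sup>2"
    by (intro power_mono; simp)+
  then have "c * (norm p)\<^sup>2 \<le> c * 4" "c * (norm m)\<^sup>2 \<le> c * 4"
    using c by (auto intro: mult_left_mono)
  \<comment> \<open>Both form values lie in \<open>[0, 4 * c]\<close>; as neither is negative, their
    difference is at most \<open>4 * c\<close> in absolute value, not \<open>8 * c\<close>.\<close>
  ultimately show ?thesis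
    using nonneg[of p] nonneg[of m] le[of p] le[of m] by linarith
qed

section \<open>Interpolation errors\<close>

lemma has_derivative_partial:
  assumes "g differentiable (at x)"
  shows "(g has_derivative (\<lambda>y. \<Sum>i\<in>UNIV. y $ i * partial i g x)) (at x)"
proof -
  let ?D = "frechet_derivative g (at x)"
  have D: "(g has_derivative ?D) (at x)"
    using assms frechet_derivative_works by blast
  then have lin: "linear ?D" by (rule has_derivative_linear)
  have "?D y = (\<Sum>i\<in>UNIV. y $ i * partial i g x)" for y
  proof -
    have "?D y = ?D (\<Sum>i\<in>UNIV. y $ i *\<^sub>R axis i 1)"
      using basis_expansion[of y] by (simp add: scalar_mult_eq_scaleR)
    also have "\<dots> = (\<Sum>i\<in>UNIV. y $ i * partial i g x)"
      by (simp add: linear_sum[OF lin] linear_cmul[OF lin] partial_def)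
    finally show ?thesis .
  qed
  then have "?D = (\<lambda>y. \<Sum>i\<in>UNIV. y $ i * partial i g x)" by (rule ext)
  with D show ?thesis by simp
qed

text \<open>The one-dimensional mean value theorem along the segment. The intermediate point stays
  in any convex set containing both ends, which is where the derivative bounds are
  available.\<close>

lemma mvt_segment:
  fixes g :: "'a::real_normed_vector \<Rightarrow> real"
  assumes "\<And>z. z \<in> closed_segment x y \<Longrightarrow> (g has_derivative g' z) (at z)"
  shows "\<exists>z\<in>closed_segment x y. g y - g x = g' z (y - x)"
proof -
  let ?l = "\<lambda>t::real. x + t *\<^sub>R (y - x)"
  have seg: "?l t \<in> closed_segment x y" if "0 \<le> t" "t \<le> 1" for t
    using that unfolding in_segment by (intro exI[of _ t]) (simp add: algebra_simps)
  have "\<exists>t\<in>{0..1}. g (?l 1) - g (?l 0) = g' (?l t) ((1 - 0) *\<^sub>R (y - x))"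
  proof (rule mvt_very_simple)
    fix t :: real
    assume t: "0 \<le> t" "t \<le> 1"
    have "(?l has_derivative (\<lambda>s. s *\<^sub>R (y - x))) (at t within {0..1})"
      by (auto intro!: derivative_eq_intros)
    then show "((\<lambda>t. g (?l t)) has_derivative (\<lambda>s. g' (?l t) (s *\<^sub>R (y - x)))) (at t within {0..1})"
      using has_derivative_compose assms[OF seg[OF t]] by blast
  qed simp
  then show ?thesis using seg by fastforce
qed

lemma first_order_bound:
  assumes g: "\<And>z. g differentiable (at z)"
    and "convex s" "x \<in> s" "y \<in> s"
    and b: "\<And>z i. z \<in> s \<Longrightarrow> \<bar>partial i g z\<bar> \<le> b"
  shows "\<bar>g y - g x\<bar> \<le> b * norm1 (y - x)"
proof -
  obtain z where z: "z \<in> closed_segment x y"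
    "g y - g x = (\<Sum>i\<in>UNIV. (y - x) $ i * partial i g z)"
    using mvt_segment[of x y g, OF has_derivative_partial[OF g]] by blast
  then have "z \<in> s" using assms(2-4) closed_segment_subset by blast
  then show ?thesis unfolding z(2) by (intro abs_sum_mult_le_norm1 b)
qed

text \<open>The mean value theorem moves the gradient to some \<open>z\<close>; a second
  application, to each partial derivative, compares it with the gradient at \<open>x\<close>. The
  constant is therefore 1 instead of Taylor's 1/2.\<close>

lemma second_order_bound:
  assumes g: "\<And>z. g differentiable (at z)"
    and pg: "\<And>z i. partial i g differentiable (at z)"
    and s: "convex s" "x \<in> s" "y \<in> s"
    and b: "\<And>z i j. z \<in> s \<Longrightarrow> \<bar>partial i (partial j g) z\<bar> \<le> b"
  shows "\<bar>g y - g x - (\<Sum>i\<in>UNIV. (y - x) $ i * partial i g x)\<bar> \<le> b * (norm1 (y - x))\<^sup>2"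
proof -
  obtain z where z: "z \<in> closed_segment x y"
    "g y - g x = (\<Sum>i\<in>UNIV. (y - x) $ i * partial i g z)"
    using mvt_segment[of x y g, OF has_derivative_partial[OF g]] by blast
  have zs: "z \<in> s" using z(1) s closed_segment_subset by blast
  have b0: "b \<ge> 0" using b[OF s(2)] abs_ge_zero order_trans by blast
  have "norm1 (z - x) \<le> norm1 (y - x)"
  proof -
    from z(1) obtain t where t: "0 \<le> t" "t \<le> 1" "z = (1 - t) *\<^sub>R x + t *\<^sub>R y"
      unfolding in_segment by blast
    then have "z - x = t *\<^sub>R (y - x)" by (simp add: algebra_simps)
    then show ?thesis
      unfolding norm1_def using t by (auto intro!: sum_mono simp: abs_mult mult_left_le_one_le)
  qed
  then have "\<bar>partial i g z - partial i g x\<bar> \<le> b * norm1 (y - x)" for i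
    using first_order_bound[of "partial i g", OF pg s(1,2) zs b] b0
    by (meson mult_left_mono order_trans)
  then have "\<bar>\<Sum>i\<in>UNIV. (y - x) $ i * (partial i g z - partial i g x)\<bar>
      \<le> b * norm1 (y - x) * norm1 (y - x)"
    by (rule abs_sum_mult_le_norm1)
  then show ?thesis
    unfolding z(2) by (simp add: sum_subtractf right_diff_distrib power2_eq_square mult.assoc)
qed

section \<open>Errors of barycentric averages\<close>

text \<open>Since \<open>x\<close> is the barycentre, the weighted displacements
  \<open>v - x\<close> sum to zero, so any linear term \<open>a\<close> averages out and only
  second-order remainders survive.\<close>

lemma weighted_interpolation_error:
  fixes c :: "real ^ 'n \<Rightarrow> real" and W :: "(real ^ 'n) set"
  assumes c: "\<And>v. v \<in> W \<Longrightarrow> c v \<ge> 0" "sum c W = 1" "(\<Sum>v\<in>W. c v *\<^sub>R v) = x"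
    and e: "\<And>v. v \<in> W \<Longrightarrow> \<bar>g v - g x - (\<Sum>i\<in>UNIV. (v - x) $ i * a i)\<bar> \<le> e"
  shows "\<bar>(\<Sum>v\<in>W. c v * g v) - g x\<bar> \<le> e"
proof -
  define r where "r v = g v - g x - (\<Sum>i\<in>UNIV. (v - x) $ i * a i)" for v
  have "(\<Sum>v\<in>W. c v *\<^sub>R (v - x)) = 0"
    using c(2,3) by (simp add: scaleR_diff_right sum_subtractf flip: scaleR_sum_left)
  then have "(\<Sum>v\<in>W. c v *\<^sub>R (v - x)) $ i = 0" for i by simp
  then have "(\<Sum>v\<in>W. c v * (v - x) $ i) = 0" for i
    by (simp only: sum_component vector_scaleR_component real_scaleR_def)
  then have "(\<Sum>v\<in>W. c v * (\<Sum>i\<in>UNIV. (v - x) $ i * a i)) = 0"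
    unfolding sum_distrib_left
    by (subst sum.swap) (simp add: mult.assoc[symmetric] flip: sum_distrib_right)
  then have "(\<Sum>v\<in>W. c v * g v) - g x = (\<Sum>v\<in>W. c v * r v)"
    using c(2) unfolding r_def
    by (simp add: right_diff_distrib sum_subtractf flip: sum_distrib_right)
  also have "\<bar>\<dots>\<bar> \<le> (\<Sum>v\<in>W. c v * e)"
    using c(1) e unfolding r_def
    by (intro order_trans[OF sum_abs] sum_mono) (simp add: abs_mult mult_left_mono)
  also have "\<dots> = e" using c(2) by (simp flip: sum_distrib_right)
  finally show ?thesis .
qed

text \<open>The two factors vary independently around their values at the centre, so the error of the
  product splits into the interpolation error of \<open>g\<close> and a covariance term.\<close>

lemma weighted_product_error:
  fixes c p g :: "'a \<Rightarrow> real"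
  assumes c: "\<And>v. v \<in> W \<Longrightarrow> c v \<ge> 0" "sum c W = 1"
    and p0: "(\<Sum>v\<in>W. c v * p v) = p0" "\<bar>p0\<bar> \<le> m"
    and p: "\<And>v. v \<in> W \<Longrightarrow> \<bar>p v - p0\<bar> \<le> a"
    and g: "\<And>v. v \<in> W \<Longrightarrow> \<bar>g v - g0\<bar> \<le> b"
    and e: "\<bar>(\<Sum>v\<in>W. c v * g v) - g0\<bar> \<le> e"
  shows "\<bar>(\<Sum>v\<in>W. c v * (p v * g v)) - p0 * g0\<bar> \<le> m * e + a * b"
proof -
  \<comment> \<open>The covariance of \<open>p\<close> and \<open>g\<close>. As \<open>p0\<close> is
    the exact mean of \<open>p\<close>, the term in which \<open>g0\<close> multiplies the averaging
    error of \<open>p\<close> vanishes.\<close>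
  define q where "q = (\<Sum>v\<in>W. c v * ((p v - p0) * (g v - g0)))"
  have "c v * ((p v - p0) * (g v - g0)) =
      c v * (p v * g v) - g0 * (c v * p v) - p0 * (c v * g v) + p0 * g0 * c v" for v
    by algebra
  then have "q = (\<Sum>v\<in>W. c v * (p v * g v)) - g0 * p0 - p0 * (\<Sum>v\<in>W. c v * g v) + p0 * g0"
    unfolding q_def p0(1)[symmetric] using c(2)
    by (simp add: sum.distrib sum_subtractf flip: sum_distrib_left)
  then have "(\<Sum>v\<in>W. c v * (p v * g v)) - p0 * g0 = p0 * ((\<Sum>v\<in>W. c v * g v) - g0) + q"
    by (simp add: algebra_simps)
  moreover have "\<bar>q\<bar> \<le> (\<Sum>v\<in>W. c v * (a * b))"
    unfolding q_def
  proof (intro order_trans[OF sum_abs] sum_mono)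
    fix v assume v: "v \<in> W"
    have "\<bar>p v - p0\<bar> * \<bar>g v - g0\<bar> \<le> a * b"
      using p[OF v] g[OF v] by (intro mult_mono) auto
    then show "\<bar>c v * ((p v - p0) * (g v - g0))\<bar> \<le> c v * (a * b)"
      using c(1)[OF v] by (simp add: abs_mult mult_left_mono)
  qed
  then have "\<bar>q\<bar> \<le> a * b" using c(2) by (simp flip: sum_distrib_right)
  moreover have "\<bar>p0 * ((\<Sum>v\<in>W. c v * g v) - g0)\<bar> \<le> m * e"
    unfolding abs_mult using p0(2) e by (intro mult_mono) auto
  ultimately show ?thesis by linarith
qed

section \<open>The interpolant on a simplex\<close>

lemma barycentric_exists:
  fixes \<SS> :: "(real ^ 'n) set"
  assumes "k simplex \<SS>" "x \<in> \<SS>"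
  obtains c where "\<And>v. v \<in> vertices \<SS> \<Longrightarrow> c v \<ge> 0" "sum c (vertices \<SS>) = 1"
    "(\<Sum>v\<in>vertices \<SS>. c v *\<^sub>R v) = x"
proof -
  have "x \<in> convex hull (vertices \<SS>)"
    using vertices_simplex(4)[OF assms(1)] assms(2) by simp
  then show thesis
    unfolding convex_hull_finite[OF vertices_simplex(1)[OF assms(1)]] using that by blast
qed

text \<open>Translating one vertex to the origin makes the others linearly independent, so
  prescribed increments extend to a linear functional.\<close>

lemma affine_interpolation:
  fixes W :: "(real ^ 'n) set"
  assumes "\<not> affine_dependent W"
  obtains w a where "\<And>v. v \<in> W \<Longrightarrow> p v = a + w \<bullet> v"
proof (cases "W = {}")
  case False
  then obtain v0 where v0: "v0 \<in> W" by blast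
  let ?B = "(\<lambda>x. -v0 + x) ` (W - {v0})"
  have "independent ?B"
    using assms affine_dependent_iff_dependent2[OF v0] by blast
  then obtain g where g: "linear g" "\<And>u. u \<in> ?B \<Longrightarrow> g u = p (v0 + u) - p v0"
    using linear_independent_extend[of ?B "\<lambda>u. p (v0 + u) - p v0"] by blast
  \<comment> \<open>For a real-valued functional, the adjoint applied to 1 is its Riesz representing
    vector.\<close>
  define w where "w = adjoint g 1"
  have w: "g u = w \<bullet> u" for u
    using adjoint_works[OF g(1), of u 1] by (simp add: w_def inner_commute)
  have "p v = (p v0 - w \<bullet> v0) + w \<bullet> v" if v: "v \<in> W" for v
  proof (cases "v = v0")
    case False
    then have "w \<bullet> (- v0 + v) = p v - p v0"
      using g(2)[of "- v0 + v"] v unfolding w by auto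
    then show ?thesis by (simp add: inner_diff_right)
  qed simp
  then show thesis using that by blast
qed (use that in blast)

lemma cpa_affine:
  fixes \<T> :: "(real ^ 'n) set set"
  assumes "full_triangulation \<T>" "\<SS> \<in> \<T>"
  obtains w a where "\<And>x. x \<in> \<SS> \<Longrightarrow> cpa \<T> p x = a + w \<bullet> x"
proof -
  have s: "int CARD('n) simplex \<SS>"
    using assms unfolding full_triangulation_def by blast
  obtain w a where p: "\<And>v. v \<in> vertices \<SS> \<Longrightarrow> p v = a + w \<bullet> v"
    using affine_interpolation[OF vertices_simplex(2)[OF s]] by blast
  have "cpa \<T> p x = a + w \<bullet> x" if x: "x \<in> \<SS>" for x
  proof -
    obtain c where c: "\<And>v. v \<in> vertices \<SS> \<Longrightarrow> c v \<ge> 0" "sum c (vertices \<SS>) = 1"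
      "(\<Sum>v\<in>vertices \<SS>. c v *\<^sub>R v) = x"
      using barycentric_exists[OF s x] by metis
    have "cpa \<T> p x = (\<Sum>v\<in>vertices \<SS>. c v * (a + w \<bullet> v))"
      using cpa_eq[OF assms c(1,2)] c(3) p by simp
    also have "\<dots> = a + w \<bullet> (\<Sum>v\<in>vertices \<SS>. c v *\<^sub>R v)"
      using c(2) by (simp add: distrib_left sum.distrib inner_sum_right flip: sum_distrib_right)
    finally show ?thesis using c(3) by simp
  qed
  then show thesis using that by blast
qed

text \<open>Uniqueness for the \<open>THE\<close> requires an interior point; full dimension
  provides one, because the relative interior is then the interior.\<close>

lemma simplex_gradient_affine:
  fixes \<SS> :: "(real ^ 'n) set"
  assumes s: "int CARD('n) simplex \<SS>" and g: "\<And>x. x \<in> \<SS> \<Longrightarrow> g x = a + w \<bullet> x"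
  shows "simplex_gradient \<SS> g = w"
  unfolding simplex_gradient_def
proof (rule the_equality)
  have der: "GDERIV g x :> w" if x: "x \<in> interior \<SS>" for x
    unfolding gderiv_def
  proof (rule has_derivative_transform_within_open[OF _ open_interior x])
    show "((\<lambda>x. a + w \<bullet> x) has_derivative (\<lambda>h. h \<bullet> w)) (at x)"
      by (auto intro!: derivative_eq_intros simp: inner_commute)
  qed (use g interior_subset in force)
  then show "\<forall>x\<in>interior \<SS>. GDERIV g x :> w" by blast
  have "\<SS> \<noteq> {}" using s by auto
  then have "interior \<SS> \<noteq> {}"
    using aff_dim_simplex[OF s] convex_simplex[OF s]
    by (simp add: interior_rel_interior_gen rel_interior_eq_empty)
  then obtain x where x: "x \<in> interior \<SS>" by blast
  fix w' assume "\<forall>x\<in>interior \<SS>. GDERIV g x :> w'"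
  then have "(\<lambda>h. h \<bullet> w') = (\<lambda>h. h \<bullet> w)"
    using der[OF x] x unfolding gderiv_def by (intro has_derivative_unique[of g]) auto
  \<comment> \<open>Testing the two equal functionals on \<open>w' - w\<close> itself forces this
    vector to be zero.\<close>
  then have "(w' - w) \<bullet> w' = (w' - w) \<bullet> w" by (rule fun_cong)
  then have "(w' - w) \<bullet> (w' - w) = 0" by (simp only: inner_diff_right)
  then show "w' = w" by simp
qed

text \<open>The gradient is read off in the interior, but the increment formula holds up to the
  boundary because the interpolant is affine on the closed simplex.\<close>

lemma cpa_matrix_affine:
  fixes \<T> :: "(real ^ 'n) set set"
  assumes "full_triangulation \<T>" "\<SS> \<in> \<T>" "x \<in> \<SS>" "y \<in> \<SS>"
  shows "cpa_matrix \<T> V y $ i $ j - cpa_matrix \<T> V x $ i $ j = cpa_gradient \<T> V \<SS> i j \<bullet> (y - x)"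
proof -
  obtain w a where w: "\<And>x. x \<in> \<SS> \<Longrightarrow> cpa \<T> (\<lambda>v. V v $ i $ j) x = a + w \<bullet> x"
    using cpa_affine[OF assms(1,2)] by blast
  have "int CARD('n) simplex \<SS>"
    using assms(1,2) unfolding full_triangulation_def by blast
  then have "cpa_gradient \<T> V \<SS> i j = w"
    unfolding cpa_gradient_def by (rule simplex_gradient_affine) (simp add: cpa_matrix_def w)
  then show ?thesis
    using w assms(3,4) by (simp add: cpa_matrix_def inner_diff_right)
qed

lemma cpa_matrix_barycentric:
  fixes \<T> :: "(real ^ 'n) set set"
  assumes "full_triangulation \<T>" "\<SS> \<in> \<T>"
    and "\<And>v. v \<in> vertices \<SS> \<Longrightarrow> c v \<ge> 0" "sum c (vertices \<SS>) = 1"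
    and "(\<Sum>v\<in>vertices \<SS>. c v *\<^sub>R v) = x"
  shows "cpa_matrix \<T> V x = (\<Sum>v\<in>vertices \<SS>. c v *\<^sub>R V v)"
  using cpa_eq[OF assms(1-4)] assms(5) by (simp add: vec_eq_iff cpa_matrix_def)

section \<open>Closed covers and difference quotients\<close>

text \<open>Convexity keeps the segment from \<open>x\<close> to \<open>y\<close> inside
  \<open>U\<close>. Pulling the cover back to the parameter interval gives finitely many closed
  pieces, across which Lipschitz bounds glue without loss.\<close>

lemma lipschitz_on_convex_closed_cover:
  fixes g :: "'a::real_normed_vector \<Rightarrow> 'b::metric_space"
  assumes U: "convex U" "U \<subseteq> \<Union>\<T>" and fin: "finite \<T>"
    and cl: "\<And>s. s \<in> \<T> \<Longrightarrow> closed s"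
    and lip: "\<And>s. s \<in> \<T> \<Longrightarrow> L-lipschitz_on s g" and L: "L \<ge> 0"
  shows "L-lipschitz_on U g"
proof (rule lipschitz_onI[OF _ L])
  fix x y assume xy: "x \<in> U" "y \<in> U"
  let ?l = "\<lambda>t::real. x + t *\<^sub>R (y - x)"
  have cont: "continuous_on UNIV ?l" by (intro continuous_intros)
  have l: "(norm (y - x))-lipschitz_on A ?l" for A
  proof (rule lipschitz_onI)
    show "dist (?l t) (?l t') \<le> norm (y - x) * dist t t'" for t t'
      by (simp add: dist_norm mult.commute flip: scaleR_diff_left)
  qed simp
  have "(L * norm (y - x))-lipschitz_on {0..1} (\<lambda>t. g (?l t))"
  proof (rule lipschitz_on_closed_Union[where U = "\<lambda>s. ?l -` s" and I = \<T>])
    show "(L * norm (y - x))-lipschitz_on (?l -` s) (\<lambda>t. g (?l t))" if "s \<in> \<T>" for s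
      by (rule lipschitz_on_compose2[OF l]) (auto intro: lipschitz_on_subset[OF lip[OF that]])
    show "closed (?l -` s)" if "s \<in> \<T>" for s
      using closed_vimage[OF cl[OF that] cont] .
    have "?l t \<in> U" if "t \<in> {0..1}" for t
      using convexD_alt[OF U(1) xy, of t] that by (simp add: algebra_simps)
    then show "{0..1} \<subseteq> (\<Union>s\<in>\<T>. ?l -` s)" using U(2) by blast
  qed (use fin L in auto)
  from lipschitz_onD[OF this, of 0 1] show "dist (g x) (g y) \<le> L * dist x y"
    by (simp add: dist_norm norm_minus_commute)
qed

text \<open>Pigeonhole: near 0 the ray runs through finitely many sets, so it meets one of them for
  arbitrarily small \<open>h\<close>. Closedness puts \<open>x\<close> into that set, and convexity
  fills in the ray.\<close>

lemma ray_eventually_in_member: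
  fixes x d :: "'a::real_normed_vector"
  assumes fin: "finite \<T>" and cl: "\<And>s. s \<in> \<T> \<Longrightarrow> closed s" "\<And>s. s \<in> \<T> \<Longrightarrow> convex s"
    and x: "x \<in> interior (\<Union>\<T>)"
  obtains s where "s \<in> \<T>" "x \<in> s" "\<forall>\<^sub>F h in at_right 0. x + h *\<^sub>R d \<in> s"
proof -
  have lim: "((\<lambda>h. x + h *\<^sub>R d) \<longlongrightarrow> x) (at_right 0)"
    by (auto intro!: tendsto_eq_intros)
  have "\<forall>\<^sub>F h in at_right 0. x + h *\<^sub>R d \<in> interior (\<Union>\<T>)"
    using topological_tendstoD[OF lim open_interior x] .
  then have "\<forall>\<^sub>F h in at_right 0. \<exists>s\<in>\<T>. x + h *\<^sub>R d \<in> s"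
    by eventually_elim (use interior_subset in fastforce)
  then have "\<exists>\<^sub>F h in at_right 0. \<exists>s\<in>\<T>. x + h *\<^sub>R d \<in> s"
    by (rule eventually_frequently[rotated]) simp
  then have "\<exists>s\<in>\<T>. \<exists>\<^sub>F h in at_right 0. x + h *\<^sub>R d \<in> s"
    by (rule frequently_bex_finite[OF fin])
  then obtain s where s: "s \<in> \<T>" "\<exists>\<^sub>F h in at_right 0. x + h *\<^sub>R d \<in> s"
    by blast
  have xs: "x \<in> s"
  proof (rule ccontr)
    assume "x \<notin> s"
    then have "\<forall>\<^sub>F h in at_right 0. x + h *\<^sub>R d \<in> - s"
      using topological_tendstoD[OF lim] cl(1)[OF s(1)] by blast
    with s(2) show False by (simp add: frequently_def)
  qed
  have "\<exists>\<^sub>F h in at_right 0. (0::real) < h \<and> x + h *\<^sub>R d \<in> s"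
    using s(2) by (rule frequently_rev_mp)
      (auto intro: eventually_mono[OF eventually_at_right_less[of "0::real"]])
  then obtain h0 where h0: "h0 > 0" "x + h0 *\<^sub>R d \<in> s"
    using frequently_ex by blast
  have "x + h *\<^sub>R d \<in> s" if h: "0 < h" "h < h0" for h
  proof -
    have "(1 - h / h0) *\<^sub>R x + (h / h0) *\<^sub>R (x + h0 *\<^sub>R d) \<in> s"
      using convexD_alt[OF cl(2)[OF s(1)] xs h0(2), of "h / h0"] h by simp
    then show ?thesis using h0 by (simp add: algebra_simps)
  qed
  then have "\<forall>\<^sub>F h in at_right 0. x + h *\<^sub>R d \<in> s"
    unfolding eventually_at_right_field using h0(1) by blast
  then show thesis using that s(1) xs by blast
qed

text \<open>For a Lipschitz \<open>g\<close> the curve may be replaced by its tangent ray in the difference quotient.\<close>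

lemma lipschitz_quotient_along_curve:
  fixes \<gamma> :: "real \<Rightarrow> 'a::real_normed_vector" and g :: "'a \<Rightarrow> real"
  assumes \<gamma>: "(\<gamma> has_vector_derivative d) (at 0 within {0..})" "\<gamma> 0 = x"
    and lip: "L-lipschitz_on (cball x u) g" and u: "u > 0"
    and ray: "\<forall>\<^sub>F h in at_right 0. g (x + h *\<^sub>R d) - g x = h * m"
  shows "((\<lambda>h. (g (\<gamma> h) - g x) / h) \<longlongrightarrow> m) (at_right 0)"
proof -
  \<comment> \<open>The normalized tangency error of the curve, which tends to 0 by the definition
    of the derivative and dominates the quotient error up to the factor \<open>L\<close>.\<close>
  define r where "r h = (1 / \<bar>h\<bar>) *\<^sub>R (\<gamma> h - (x + h *\<^sub>R d))" for h
  have "(r \<longlongrightarrow> 0) (at 0 within {0..})"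
    using \<gamma> unfolding has_vector_derivative_def has_derivative_within r_def by simp
  then have "(r \<longlongrightarrow> 0) (at_right 0)"
    by (rule tendsto_within_subset) auto
  then have r: "((\<lambda>h. L * norm (r h)) \<longlongrightarrow> 0) (at_right 0)"
    by (auto intro!: tendsto_eq_intros simp: tendsto_norm_zero_iff)
  have cu: "x \<in> ball x u" using u by simp
  have "(\<gamma> \<longlongrightarrow> x) (at 0 within {0..})"
    using has_vector_derivative_continuous[OF \<gamma>(1)] \<gamma>(2) by (simp add: continuous_within)
  then have "(\<gamma> \<longlongrightarrow> x) (at_right 0)"
    by (rule tendsto_within_subset) auto
  from topological_tendstoD[OF this open_ball cu]
  have in1: "\<forall>\<^sub>F h in at_right 0. \<gamma> h \<in> ball x u" .
  have "((\<lambda>h. x + h *\<^sub>R d) \<longlongrightarrow> x) (at_right 0)"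
    by (auto intro!: tendsto_eq_intros)
  from topological_tendstoD[OF this open_ball cu]
  have in2: "\<forall>\<^sub>F h in at_right 0. x + h *\<^sub>R d \<in> ball x u" .
  have "\<forall>\<^sub>F h in at_right 0. norm ((g (\<gamma> h) - g x) / h - m) \<le> L * norm (r h)"
    using in1 in2 ray eventually_at_right_less[of "0::real"]
  proof eventually_elim
    case (elim h)
    have "(g (\<gamma> h) - g x) / h - m = (g (\<gamma> h) - g (x + h *\<^sub>R d)) / h"
      using elim(3,4) by (simp add: field_simps)
    moreover have "\<bar>g (\<gamma> h) - g (x + h *\<^sub>R d)\<bar> \<le> L * norm (\<gamma> h - (x + h *\<^sub>R d))"
      using lipschitz_onD[OF lip, of "\<gamma> h" "x + h *\<^sub>R d"] elim(1,2)
      by (simp add: dist_norm less_imp_le)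
    ultimately show ?case
      using elim(4) by (simp add: r_def divide_right_mono)
  qed
  then have "((\<lambda>h. (g (\<gamma> h) - g x) / h - m) \<longlongrightarrow> 0) (at_right 0)"
    by (rule Lim_null_comparison[OF _ r])
  then show ?thesis using Lim_null by blast
qed

section \<open>The contraction estimate on a simplex\<close>

lemma C_k_3D:
  assumes "C_k 3 f"
  shows "(\<lambda>y. f y $ l) differentiable (at x)"
    "partial i (\<lambda>y. f y $ l) differentiable (at x)"
    "partial i (partial j (\<lambda>y. f y $ l)) differentiable (at x)"
  using assms by (auto simp: C_k_def numeral_3_eq_3)

text \<open>Links the Jacobian matrix to the iterated partial derivatives in which the bounds on
  \<open>f\<close> are stated.\<close>

lemma jacobian_entry:
  fixes f :: "real ^ 'n \<Rightarrow> real ^ 'm"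
  assumes "\<And>l. (\<lambda>y. f y $ l) differentiable (at x)"
  shows "Jac f x $ l $ j = partial j (\<lambda>y. f y $ l) x"
proof -
  have "(f has_derivative (\<lambda>h. \<chi> l. \<Sum>i\<in>UNIV. h $ i * partial i (\<lambda>y. f y $ l) x)) (at x)"
    unfolding has_derivative_componentwise_within[of f]
    by (auto simp: Basis_vec_def inner_axis intro!: has_derivative_partial assms)
  then have "frechet_derivative f (at x) = (\<lambda>h. \<chi> l. \<Sum>i\<in>UNIV. h $ i * partial i (\<lambda>y. f y $ l) x)"
    by (rule frechet_derivative_at[symmetric])
  then show ?thesis
    by (simp add: jacobian_def matrix_def axis_def if_distrib if_distribR cong: if_cong)
qed

lemma quadratic_form_weighted_sum:
  fixes A :: "'a \<Rightarrow> real ^ 'n ^ 'n"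
  shows "v \<bullet> ((\<Sum>k\<in>W. c k *\<^sub>R A k) *v v) = (\<Sum>k\<in>W. c k * (v \<bullet> (A k *v v)))"
  by (induction W rule: infinite_finite_induct)
    (simp_all add: matrix_vector_mult_add_rdistrib inner_add_right flip: scaleR_matrix_vector_assoc)

lemma cpa_matrix_vertex:
  fixes \<T> :: "(real ^ 'n) set set"
  assumes "full_triangulation \<T>" "\<SS> \<in> \<T>" "v \<in> vertices \<SS>"
  shows "cpa_matrix \<T> V v = V v"
proof -
  have "int CARD('n) simplex \<SS>"
    using assms(1,2) unfolding full_triangulation_def by blast
  note fin = vertices_simplex(1)[OF this]
  show ?thesis
    using cpa_matrix_barycentric[OF assms(1,2), of "\<lambda>u. if u = v then 1 else 0" v V] assms(3) fin
    by (simp add: if_distrib[of "\<lambda>a. a *\<^sub>R _"] cong: if_cong)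
qed

text \<open>\<open>A_mat\<close> with the interpolant in place of the vertex values: it makes sense
  throughout the simplex and agrees with \<open>A_mat\<close> at the vertices.\<close>

definition A_cpa ::
  "(real ^ 'n \<Rightarrow> real ^ 'n) \<Rightarrow> (real ^ 'n) set set \<Rightarrow> (real ^ 'n \<Rightarrow> real ^ 'n ^ 'n) \<Rightarrow>
   (real ^ 'n) set \<Rightarrow> real ^ 'n \<Rightarrow> real ^ 'n ^ 'n" where
  "A_cpa f \<T> V \<SS> x =
     cpa_matrix \<T> V x ** Jac f x + transpose (Jac f x) ** cpa_matrix \<T> V x
       + (\<chi> i j. cpa_gradient \<T> V \<SS> i j \<bullet> f x)"

lemma A_cpa_vertex:
  assumes "full_triangulation \<T>" "\<SS> \<in> \<T>" "v \<in> vertices \<SS>"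
  shows "A_cpa f \<T> V \<SS> v = A_mat f \<T> V \<SS> v"
  by (simp add: A_cpa_def A_mat_def cpa_matrix_vertex[OF assms])

text \<open>Each entry consists of \<open>2 * n\<close> products of \<open>P\<close> with first
  derivatives of \<open>f\<close>, plus the gradient term. A product contributes the interpolation
  error of \<open>Df\<close> (via \<open>b3\<close>) and a covariance; the gradient term contributes
  the interpolation error of \<open>f\<close> (via \<open>b\<close>).\<close>

lemma A_cpa_interpolation_error:
  fixes f :: "real ^ 'n \<Rightarrow> real ^ 'n"
  assumes f: "C_k 3 f" and T: "full_triangulation \<T>" "\<SS> \<in> \<T>"
    and b: "\<And>x i j k. x \<in> \<SS> \<Longrightarrow> \<bar>partial i (partial j (\<lambda>y. f y $ k)) x\<bar> \<le> b"
    and b3: "\<And>x i j k l. x \<in> \<SS> \<Longrightarrow> \<bar>partial i (partial j (partial k (\<lambda>y. f y $ l))) x\<bar> \<le> b3"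
    and m: "\<And>i j. \<bar>cpa_matrix \<T> V x $ i $ j\<bar> \<le> m"
    and d: "\<And>i j. norm1 (cpa_gradient \<T> V \<SS> i j) \<le> d"
    and c: "\<And>v. v \<in> vertices \<SS> \<Longrightarrow> c v \<ge> 0" "sum c (vertices \<SS>) = 1"
      "(\<Sum>v\<in>vertices \<SS>. c v *\<^sub>R v) = x"
    and x: "x \<in> \<SS>"
  defines "n \<equiv> real CARD('n)" and "h \<equiv> diameter \<SS>"
  shows "\<bar>((\<Sum>v\<in>vertices \<SS>. c v *\<^sub>R A_cpa f \<T> V \<SS> v) - A_cpa f \<T> V \<SS> x) $ i $ j\<bar>
    \<le> 2 * n * (m * (b3 * (n * h\<^sup>2)) + d * h * (b * (sqrt n * h))) + d * (b * (n * h\<^sup>2))"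
proof -
  define W where "W = vertices \<SS>"
  define P where "P = cpa_matrix \<T> V"
  define w where "w = cpa_gradient \<T> V \<SS>"
  define J where "J l j y = partial j (\<lambda>y. f y $ l) y" for l j y
  have spx: "int CARD('n) simplex \<SS>"
    using T unfolding full_triangulation_def by blast
  have cvx: "convex \<SS>" using convex_simplex[OF spx] .
  have bdd: "bounded \<SS>" using compact_simplex[OF spx] compact_imp_bounded by blast
  have WS: "v \<in> \<SS>" if "v \<in> W" for v
    using that vertices_simplex(4)[OF spx] hull_inc[of v "vertices \<SS>" convex] by (simp add: W_def)
  note c = c[folded W_def]
  have Px: "P x = (\<Sum>v\<in>W. c v *\<^sub>R P v)"
    using cpa_matrix_barycentric[OF T c[unfolded W_def], of V]
    by (simp add: P_def W_def cpa_matrix_vertex[OF T])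
  have b0: "b \<ge> 0" "b3 \<ge> 0" using b[OF x] b3[OF x] abs_ge_zero order_trans by blast+
  have d0: "d \<ge> 0" using d norm1_nonneg order_trans by blast
  have nh: "norm (v - x) \<le> h" if "v \<in> W" for v
    using diameter_bounded_bound[OF bdd WS[OF that] x] by (simp add: h_def dist_norm)
  have h0: "h \<ge> 0" using diameter_ge_0[OF bdd] by (simp add: h_def)
  have n1: "norm1 (v - x) \<le> sqrt n * h" if "v \<in> W" for v
    unfolding n_def by (rule order_trans[OF norm1_le mult_left_mono[OF nh[OF that]]]) simp
  have n2: "(norm1 (v - x))\<^sup>2 \<le> n * h\<^sup>2" if "v \<in> W" for v
    unfolding n_def
    by (rule order_trans[OF norm1_power2_le mult_left_mono[OF power_mono[OF nh[OF that]]]]) simp_all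
  have e1: "\<bar>(\<Sum>v\<in>W. c v * f v $ k) - f x $ k\<bar> \<le> b * (n * h\<^sup>2)" for k
  proof (rule weighted_interpolation_error[OF c])
    fix v assume v: "v \<in> W"
    show "\<bar>f v $ k - f x $ k - (\<Sum>i\<in>UNIV. (v - x) $ i * partial i (\<lambda>y. f y $ k) x)\<bar> \<le> b * (n * h\<^sup>2)"
      by (rule order_trans[OF second_order_bound[OF C_k_3D(1,2)[OF f] cvx x WS[OF v] b]
            mult_left_mono[OF n2[OF v] b0(1)]])
  qed
  have e2: "\<bar>(\<Sum>v\<in>W. c v * J l j v) - J l j x\<bar> \<le> b3 * (n * h\<^sup>2)" for l j
  proof (rule weighted_interpolation_error[OF c])
    fix v assume v: "v \<in> W"
    show "\<bar>J l j v - J l j x - (\<Sum>i\<in>UNIV. (v - x) $ i * partial i (partial j (\<lambda>y. f y $ l)) x)\<bar>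
        \<le> b3 * (n * h\<^sup>2)"
      unfolding J_def
      by (rule order_trans[OF second_order_bound[OF C_k_3D(2,3)[OF f] cvx x WS[OF v] b3]
            mult_left_mono[OF n2[OF v] b0(2)]])
  qed
  have e3: "\<bar>J l j v - J l j x\<bar> \<le> b * (sqrt n * h)" if v: "v \<in> W" for l j v
    unfolding J_def
    by (rule order_trans[OF first_order_bound[OF C_k_3D(2)[OF f] cvx x WS[OF v] b]
          mult_left_mono[OF n1[OF v] b0(1)]])
  \<comment> \<open>Components of \<open>v - x\<close> are at most \<open>h\<close>, so Hoelder
    avoids a \<open>sqrt n\<close> in this factor of the covariance.\<close>
  have e4: "\<bar>P v $ i $ j - P x $ i $ j\<bar> \<le> d * h" if v: "v \<in> W" for i j v
  proof -
    have "\<bar>(v - x) $ k\<bar> \<le> h" for k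
      using component_le_norm_cart[of "v - x" k] nh[OF v] by linarith
    then have "\<bar>w i j \<bullet> (v - x)\<bar> \<le> norm1 (w i j) * h"
      by (rule abs_inner_le_norm1)
    also have "\<dots> \<le> d * h"
      using d h0 by (intro mult_right_mono) (auto simp: w_def)
    finally show ?thesis
      using cpa_matrix_affine[OF T x WS[OF v], of V i j] by (simp add: P_def w_def)
  qed
  define q where "q = m * (b3 * (n * h\<^sup>2)) + d * h * (b * (sqrt n * h))"
  have e5: "\<bar>(\<Sum>v\<in>W. c v * (P v $ i $ k * J l j v)) - P x $ i $ k * J l j x\<bar> \<le> q" for i k l j
    unfolding q_def
  proof (rule weighted_product_error[OF c(1,2)])
    show "(\<Sum>v\<in>W. c v * P v $ i $ k) = P x $ i $ k" by (simp add: Px)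
  qed (use m e2 e3 e4 in \<open>auto simp: P_def\<close>)
  have entry: "A_cpa f \<T> V \<SS> y $ i $ j =
      (\<Sum>l\<in>UNIV. P y $ i $ l * J l j y) + (\<Sum>l\<in>UNIV. P y $ l $ j * J l i y)
       + (\<Sum>k\<in>UNIV. w i j $ k * f y $ k)" for y
    unfolding A_cpa_def P_def J_def w_def
    by (simp add: matrix_matrix_mult_def transpose_def inner_vec_def jacobian_entry[OF C_k_3D(1)[OF f]]
        mult.commute)
  have sw: "(\<Sum>v\<in>W. c v * (\<Sum>l\<in>UNIV. F l v)) - (\<Sum>l\<in>UNIV. F l x)
      = (\<Sum>l\<in>UNIV. (\<Sum>v\<in>W. c v * F l v) - F l x)"
    for F :: "'n \<Rightarrow> real ^ 'n \<Rightarrow> real"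
    unfolding sum_distrib_left sum_subtractf by (simp only: sum.swap[of _ W UNIV])
  \<comment> \<open>The gradient is constant on the simplex and can be pulled out of the
    average.\<close>
  have fw: "(\<Sum>v\<in>W. c v * (w i j $ k * f v $ k)) - w i j $ k * f x $ k
      = w i j $ k * ((\<Sum>v\<in>W. c v * f v $ k) - f x $ k)" for k
    by (simp add: sum_distrib_left right_diff_distrib mult.left_commute)
  have "((\<Sum>v\<in>W. c v *\<^sub>R A_cpa f \<T> V \<SS> v) - A_cpa f \<T> V \<SS> x) $ i $ j =
     (\<Sum>v\<in>W. c v * A_cpa f \<T> V \<SS> v $ i $ j) - A_cpa f \<T> V \<SS> x $ i $ j"
    by simp
  also have "\<dots> = (\<Sum>l\<in>UNIV. (\<Sum>v\<in>W. c v * (P v $ i $ l * J l j v)) - P x $ i $ l * J l j x)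
      + (\<Sum>l\<in>UNIV. (\<Sum>v\<in>W. c v * (P v $ l $ j * J l i v)) - P x $ l $ j * J l i x)
      + (\<Sum>k\<in>UNIV. w i j $ k * ((\<Sum>v\<in>W. c v * f v $ k) - f x $ k))"
    using sw[of "\<lambda>l v. P v $ i $ l * J l j v"] sw[of "\<lambda>l v. P v $ l $ j * J l i v"]
      sw[of "\<lambda>k v. w i j $ k * f v $ k"]
    unfolding entry distrib_left sum.distrib fw by linarith
  finally have split: "((\<Sum>v\<in>W. c v *\<^sub>R A_cpa f \<T> V \<SS> v) - A_cpa f \<T> V \<SS> x) $ i $ j = \<dots>" .
  have sq: "\<bar>\<Sum>l\<in>UNIV. F l\<bar> \<le> n * q" if "\<And>l. \<bar>F l\<bar> \<le> q" for F :: "'n \<Rightarrow> real"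
    unfolding n_def using sum_bounded_above[of UNIV "\<lambda>l. \<bar>F l\<bar>" q] that
    by (intro order_trans[OF sum_abs]) simp
  have "\<bar>\<Sum>k\<in>UNIV. w i j $ k * ((\<Sum>v\<in>W. c v * f v $ k) - f x $ k)\<bar> \<le> b * (n * h\<^sup>2) * norm1 (w i j)"
    by (rule abs_sum_mult_le_norm1) (rule e1)
  also have "\<dots> \<le> b * (n * h\<^sup>2) * d"
    using d b0 by (intro mult_left_mono) (auto simp: w_def n_def)
  finally have "\<bar>\<Sum>k\<in>UNIV. w i j $ k * ((\<Sum>v\<in>W. c v * f v $ k) - f x $ k)\<bar> \<le> d * (b * (n * h\<^sup>2))"
    by (simp add: mult.commute)
  with sq[of "\<lambda>l. (\<Sum>v\<in>W. c v * (P v $ i $ l * J l j v)) - P x $ i $ l * J l j x", OF e5]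
    sq[of "\<lambda>l. (\<Sum>v\<in>W. c v * (P v $ l $ j * J l i v)) - P x $ l $ j * J l i x", OF e5]
  show ?thesis
    unfolding W_def[symmetric] q_def[symmetric] split by linarith
qed

text \<open>All three properties are stable under convex combinations, and the interpolant at
  \<open>x\<close> is such a combination of its vertex values.\<close>

lemma
  fixes \<T> :: "(real ^ 'n) set set"
  assumes T: "full_triangulation \<T>" "\<SS> \<in> \<T>" "x \<in> \<SS>"
  shows cpa_matrix_form_ge: "(\<And>v. v \<in> vertices \<SS> \<Longrightarrow> mat e \<preceq>\<^sub>L V v) \<Longrightarrow>
      e * (norm u)\<^sup>2 \<le> u \<bullet> (cpa_matrix \<T> V x *v u)"
    and cpa_matrix_form_le: "(\<And>v. v \<in> vertices \<SS> \<Longrightarrow> V v \<preceq>\<^sub>L mat m) \<Longrightarrow>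
      u \<bullet> (cpa_matrix \<T> V x *v u) \<le> m * (norm u)\<^sup>2"
    and cpa_matrix_symmetric: "(\<And>v. v \<in> vertices \<SS> \<Longrightarrow> symmetric_matrix (V v)) \<Longrightarrow>
      symmetric_matrix (cpa_matrix \<T> V x)"
proof -
  have s: "int CARD('n) simplex \<SS>"
    using T unfolding full_triangulation_def by blast
  obtain c where c: "\<And>v. v \<in> vertices \<SS> \<Longrightarrow> c v \<ge> 0" "sum c (vertices \<SS>) = 1"
    "(\<Sum>v\<in>vertices \<SS>. c v *\<^sub>R v) = x"
    using barycentric_exists[OF s T(3)] by metis
  have P: "cpa_matrix \<T> V x = (\<Sum>v\<in>vertices \<SS>. c v *\<^sub>R V v)"
    by (rule cpa_matrix_barycentric[OF T(1,2) c])
  have form: "u \<bullet> (cpa_matrix \<T> V x *v u) = (\<Sum>v\<in>vertices \<SS>. c v * (u \<bullet> (V v *v u)))"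
    unfolding P by (rule quadratic_form_weighted_sum)
  \<comment> \<open>Weights summing to 1 turn a constant into an average, so the comparison can be
    made vertex by vertex.\<close>
  have const: "k * (norm u)\<^sup>2 = (\<Sum>v\<in>vertices \<SS>. c v * (k * (norm u)\<^sup>2))" for k
    using c(2) by (simp flip: sum_distrib_right)
  show "e * (norm u)\<^sup>2 \<le> u \<bullet> (cpa_matrix \<T> V x *v u)"
    if V: "\<And>v. v \<in> vertices \<SS> \<Longrightarrow> mat e \<preceq>\<^sub>L V v"
    unfolding form
    by (subst const, intro sum_mono mult_left_mono c(1)) (use loewner_le_form[OF V] in \<open>auto simp: form_mat\<close>)
  show "u \<bullet> (cpa_matrix \<T> V x *v u) \<le> m * (norm u)\<^sup>2"
    if V: "\<And>v. v \<in> vertices \<SS> \<Longrightarrow> V v \<preceq>\<^sub>L mat m"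
    unfolding form
    by (subst const, intro sum_mono mult_left_mono c(1)) (use loewner_le_form[OF V] in \<open>auto simp: form_mat\<close>)
  show "symmetric_matrix (cpa_matrix \<T> V x)"
    if V: "\<And>v. v \<in> vertices \<SS> \<Longrightarrow> symmetric_matrix (V v)"
    unfolding P symmetric_matrix_def
    by (simp add: vec_eq_iff transpose_def) (use symmetric_matrix_entry[OF V] in \<open>auto intro: sum.cong\<close>)
qed

text \<open>The margin \<open>h\<^sup>2 * E\<close> built into the vertex constraint pays for
  passing from the vertex average to \<open>x\<close>. Here \<open>m\<close> bounds the entries of
  the interpolant and takes the place of \<open>C\<close> in \<open>E_const\<close>.\<close>

lemma A_cpa_form_le:
  fixes f :: "real ^ 'n \<Rightarrow> real ^ 'n"
  assumes f: "C_k 3 f" and T: "full_triangulation \<T>" "\<SS> \<in> \<T>" and x: "x \<in> \<SS>"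
    and b: "\<And>x i j k. x \<in> \<SS> \<Longrightarrow> \<bar>partial i (partial j (\<lambda>y. f y $ k)) x\<bar> \<le> b"
    and b3: "\<And>x i j k l. x \<in> \<SS> \<Longrightarrow> \<bar>partial i (partial j (partial k (\<lambda>y. f y $ l))) x\<bar> \<le> b3"
    and m: "\<And>i j. \<bar>cpa_matrix \<T> V x $ i $ j\<bar> \<le> m"
    and d: "\<And>i j. norm1 (cpa_gradient \<T> V \<SS> i j) \<le> d"
    and A: "\<And>v. v \<in> vertices \<SS> \<Longrightarrow>
       A_mat f \<T> V \<SS> v + mat ((diameter \<SS>)\<^sup>2 * E_const CARD('n) b b3 m d) \<preceq>\<^sub>L mat (- \<epsilon>)"
  shows "u \<bullet> (A_cpa f \<T> V \<SS> x *v u) \<le> - \<epsilon> * (norm u)\<^sup>2"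
proof -
  have s: "int CARD('n) simplex \<SS>"
    using T unfolding full_triangulation_def by blast
  obtain c where c: "\<And>v. v \<in> vertices \<SS> \<Longrightarrow> c v \<ge> 0" "sum c (vertices \<SS>) = 1"
    "(\<Sum>v\<in>vertices \<SS>. c v *\<^sub>R v) = x"
    using barycentric_exists[OF s x] by metis
  define n h where "n = real CARD('n)" and "h = diameter \<SS>"
  define E where "E = E_const CARD('n) b b3 m d"
  define err where "err = 2 * n * (m * (b3 * (n * h\<^sup>2)) + d * h * (b * (sqrt n * h))) + d * (b * (n * h\<^sup>2))"
  have b0: "b \<ge> 0" using b[OF x] abs_ge_zero order_trans by blast
  have d0: "d \<ge> 0" using d norm1_nonneg order_trans by blast
  define \<Delta> where "\<Delta> = (\<Sum>v\<in>vertices \<SS>. c v *\<^sub>R A_cpa f \<T> V \<SS> v) - A_cpa f \<T> V \<SS> x"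
  have "\<bar>\<Delta> $ i $ j\<bar> \<le> err" for i j
    unfolding \<Delta>_def err_def n_def h_def
    by (rule A_cpa_interpolation_error[OF f T b b3 m d c x])
  then have "\<bar>u \<bullet> (\<Delta> *v u)\<bar> \<le> err * n * (norm u)\<^sup>2"
    unfolding n_def by (rule quadratic_form_entrywise_bound)
  moreover have "err * n \<le> h\<^sup>2 * E"
  proof -
    \<comment> \<open>The two sides differ in the covariance term: \<open>err\<close> yields
      \<open>2 * sqrt n\<close>, while \<open>E\<close> carries \<open>4 * sqrt n\<close>.\<close>
    have "err * n = h\<^sup>2 * E - 2 * (h\<^sup>2 * (n\<^sup>2 * sqrt n * b * d))"
      unfolding err_def E_def E_const_def n_def[symmetric]
      by (simp add: power2_eq_square power3_eq_cube algebra_simps)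
    then show ?thesis using b0 d0 by (simp add: n_def)
  qed
  then have "err * n * (norm u)\<^sup>2 \<le> h\<^sup>2 * E * (norm u)\<^sup>2" by (rule mult_right_mono) simp
  moreover have "u \<bullet> (A_cpa f \<T> V \<SS> x *v u) =
      (\<Sum>v\<in>vertices \<SS>. c v * (u \<bullet> (A_cpa f \<T> V \<SS> v *v u))) - u \<bullet> (\<Delta> *v u)"
    unfolding \<Delta>_def quadratic_form_weighted_sum[symmetric]
    by (simp add: matrix_vector_mult_diff_rdistrib inner_diff_right)
  moreover have "(\<Sum>v\<in>vertices \<SS>. c v * (u \<bullet> (A_cpa f \<T> V \<SS> v *v u)))
      \<le> (\<Sum>v\<in>vertices \<SS>. c v * (- \<epsilon> * (norm u)\<^sup>2 - h\<^sup>2 * E * (norm u)\<^sup>2))"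
  proof (intro sum_mono mult_left_mono c(1))
    fix v assume v: "v \<in> vertices \<SS>"
    show "u \<bullet> (A_cpa f \<T> V \<SS> v *v u) \<le> - \<epsilon> * (norm u)\<^sup>2 - h\<^sup>2 * E * (norm u)\<^sup>2"
      using loewner_le_form[OF A[OF v], of u]
      by (simp add: A_cpa_vertex[OF T v] matrix_vector_mult_add_rdistrib inner_add_right form_mat
          h_def E_def)
  qed
  moreover have "\<dots> = - \<epsilon> * (norm u)\<^sup>2 - h\<^sup>2 * E * (norm u)\<^sup>2"
    using c(2) by (simp flip: sum_distrib_right)
  ultimately show ?thesis by linarith
qed

section \<open>Lipschitz continuity and orbital derivative\<close>

lemma norm_matrix_le_entries:
  fixes A :: "real ^ 'n ^ 'm"
  assumes "\<And>i j. \<bar>A $ i $ j\<bar> \<le> b"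
  shows "norm A \<le> real CARD('m) * (real CARD('n) * b)"
proof -
  have "norm (A $ i) \<le> real CARD('n) * b" for i
    using sum_bounded_above[of UNIV "\<lambda>j. \<bar>A $ i $ j\<bar>" b] assms
    by (intro order_trans[OF norm_le_l1_cart]) simp
  then have "(\<Sum>i\<in>UNIV. norm (A $ i)) \<le> real CARD('m) * (real CARD('n) * b)"
    using sum_bounded_above[of UNIV "\<lambda>i. norm (A $ i)" "real CARD('n) * b"] by simp
  moreover have "norm A \<le> (\<Sum>i\<in>UNIV. norm (A $ i))"
    unfolding norm_vec_def by (rule L2_set_le_sum) simp
  ultimately show ?thesis by linarith
qed

text \<open>Each entry has Lipschitz constant \<open>d\<close>, and the matrix norm is at most the
  sum of the absolute entries.\<close>

lemma cpa_matrix_lipschitz_on_simplex: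
  fixes \<T> :: "(real ^ 'n) set set"
  assumes T: "full_triangulation \<T>" "\<SS> \<in> \<T>"
    and d: "\<And>i j. norm1 (cpa_gradient \<T> V \<SS> i j) \<le> d"
  shows "(real CARD('n) * (real CARD('n) * d))-lipschitz_on \<SS> (cpa_matrix \<T> V)"
proof (rule lipschitz_onI)
  have d0: "d \<ge> 0" using d norm1_nonneg order_trans by blast
  then show "0 \<le> real CARD('n) * (real CARD('n) * d)" by simp
  fix x y assume xy: "x \<in> \<SS>" "y \<in> \<SS>"
  have "\<bar>(cpa_matrix \<T> V x - cpa_matrix \<T> V y) $ i $ j\<bar> \<le> d * dist x y" for i j
  proof -
    have "\<bar>cpa_gradient \<T> V \<SS> i j \<bullet> (x - y)\<bar> \<le> norm1 (cpa_gradient \<T> V \<SS> i j) * dist x y"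
      using component_le_norm_cart[of "x - y"] by (intro abs_inner_le_norm1) (simp add: dist_norm)
    also have "\<dots> \<le> d * dist x y" using d by (intro mult_right_mono) auto
    finally show ?thesis using cpa_matrix_affine[OF T xy(2,1), of V i j] by simp
  qed
  from norm_matrix_le_entries[OF this]
  show "dist (cpa_matrix \<T> V x) (cpa_matrix \<T> V y) \<le> real CARD('n) * (real CARD('n) * d) * dist x y"
    by (simp add: dist_norm mult.assoc)
qed

lemma full_triangulationD:
  assumes "full_triangulation \<T>"
  shows "finite \<T>" "\<And>s. s \<in> \<T> \<Longrightarrow> closed s" "\<And>s. s \<in> \<T> \<Longrightarrow> convex s"
  using assms unfolding full_triangulation_def triangulation_def
  by (auto intro: closed_simplex convex_simplex)

lemma cpa_matrix_lipschitz:
  fixes \<T> :: "(real ^ 'n) set set"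
  assumes T: "full_triangulation \<T>"
    and d: "\<And>\<SS> i j. \<SS> \<in> \<T> \<Longrightarrow> norm1 (cpa_gradient \<T> V \<SS> i j) \<le> D \<SS>"
  obtains L where "\<And>U. convex U \<Longrightarrow> U \<subseteq> \<Union>\<T> \<Longrightarrow> L-lipschitz_on U (cpa_matrix \<T> V)"
proof -
  note fin = full_triangulationD(1)[OF T]
  \<comment> \<open>The sum dominates each \<open>D \<SS>\<close>, giving one constant for all
    simplices, and it is defined even for an empty \<open>\<T>\<close>.\<close>
  define L where "L = real CARD('n) * (real CARD('n) * (\<Sum>\<SS>\<in>\<T>. D \<SS>))"
  have D0: "D \<SS> \<ge> 0" if "\<SS> \<in> \<T>" for \<SS> using d[OF that] norm1_nonneg order_trans by blast
  have "L-lipschitz_on \<SS> (cpa_matrix \<T> V)" if s: "\<SS> \<in> \<T>" for \<SS>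
  proof -
    have "norm1 (cpa_gradient \<T> V \<SS> i j) \<le> (\<Sum>\<SS>\<in>\<T>. D \<SS>)" for i j
      using d[OF s] member_le_sum[of \<SS> \<T> D, OF s _ fin] D0 by (meson DiffD1 order_trans)
    then show ?thesis unfolding L_def by (rule cpa_matrix_lipschitz_on_simplex[OF T s])
  qed
  moreover have "L \<ge> 0" unfolding L_def using D0 by (simp add: sum_nonneg)
  ultimately show thesis
    using that lipschitz_on_convex_closed_cover[OF _ _ full_triangulationD(1,2)[OF T]] by blast
qed

text \<open>On a common face the gradients of adjacent simplices may differ. The direction
  \<open>f x\<close> selects one simplex before \<open>i\<close> and \<open>j\<close> are fixed, so
  all entries use the same one.\<close>

lemma orbital_derivative_cpa:
  fixes \<T> :: "(real ^ 'n) set set"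
  assumes T: "full_triangulation \<T>" and S: "forward_flow f S"
    and x: "x \<in> interior (\<Union>\<T>)"
    and lip: "\<And>U. convex U \<Longrightarrow> U \<subseteq> \<Union>\<T> \<Longrightarrow> L-lipschitz_on U (cpa_matrix \<T> V)"
  obtains \<SS> where "\<SS> \<in> \<T>" "x \<in> \<SS>"
    "orbital_derivative S (cpa_matrix \<T> V) x = (\<chi> i j. cpa_gradient \<T> V \<SS> i j \<bullet> f x)"
proof -
  obtain \<SS> where s: "\<SS> \<in> \<T>" "x \<in> \<SS>" and ray: "\<forall>\<^sub>F h in at_right 0. x + h *\<^sub>R f x \<in> \<SS>"
    using ray_eventually_in_member[OF full_triangulationD[OF T] x] by metis
  obtain u where u: "u > 0" "cball x u \<subseteq> \<Union>\<T>"
    using x unfolding mem_interior_cball by blast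
  have flow: "((\<lambda>t. S t x) has_vector_derivative f x) (at 0 within {0..})" "S 0 x = x"
    using S unfolding forward_flow_def by (metis order_refl, blast)
  have "((\<lambda>h. (cpa_matrix \<T> V (S h x) $ i $ j - cpa_matrix \<T> V x $ i $ j) / h)
      \<longlongrightarrow> cpa_gradient \<T> V \<SS> i j \<bullet> f x) (at_right 0)" for i j
  proof (rule lipschitz_quotient_along_curve[OF flow _ u(1)])
    show "L-lipschitz_on (cball x u) (\<lambda>y. cpa_matrix \<T> V y $ i $ j)"
    proof (rule lipschitz_onI)
      fix y z assume yz: "y \<in> cball x u" "z \<in> cball x u"
      have "dist (cpa_matrix \<T> V y $ i $ j) (cpa_matrix \<T> V z $ i $ j)
          \<le> dist (cpa_matrix \<T> V y) (cpa_matrix \<T> V z)"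
        by (rule order_trans[OF dist_vec_nth_le dist_vec_nth_le])
      also have "\<dots> \<le> L * dist y z"
        using lipschitz_onD[OF lip[OF convex_cball u(2)] yz] .
      finally show "dist (cpa_matrix \<T> V y $ i $ j) (cpa_matrix \<T> V z $ i $ j) \<le> L * dist y z" .
    qed (rule lipschitz_on_nonneg[OF lip[OF convex_cball u(2)]])
    show "\<forall>\<^sub>F h in at_right 0. cpa_matrix \<T> V (x + h *\<^sub>R f x) $ i $ j - cpa_matrix \<T> V x $ i $ j
        = h * (cpa_gradient \<T> V \<SS> i j \<bullet> f x)"
      using ray by eventually_elim (simp add: cpa_matrix_affine[OF T s])
  qed
  \<comment> \<open>The quotients converge, so the limsup is this finite limit and the conversion to
    a real is exact.\<close>
  then have "Limsup (at_right 0)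
      (\<lambda>h. ereal ((cpa_matrix \<T> V (S h x) $ i $ j - cpa_matrix \<T> V x $ i $ j) / h))
      = ereal (cpa_gradient \<T> V \<SS> i j \<bullet> f x)" for i j
    by (intro lim_imp_Limsup tendsto_ereal) simp_all
  then have "orbital_derivative S (cpa_matrix \<T> V) x = (\<chi> i j. cpa_gradient \<T> V \<SS> i j \<bullet> f x)"
    unfolding orbital_derivative_def by simp
  with s show thesis using that by blast
qed

section \<open>Verification\<close>

theorem theorem4p9:
  fixes f :: "real ^ 'n \<Rightarrow> real ^ 'n"
    and S :: "real \<Rightarrow> real ^ 'n \<Rightarrow> real ^ 'n"
    and \<T> :: "(real ^ 'n) set set"
    and \<epsilon>\<^sub>0 :: real
    and B B\<^sub>3 C D :: "(real ^ 'n) set \<Rightarrow> real"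
    and V :: "real ^ 'n \<Rightarrow> real ^ 'n ^ 'n"
  assumes "C_k 3 f"
    and "forward_flow f S"
    and "full_triangulation \<T>"
    and "\<epsilon>\<^sub>0 > 0"
    and "\<And>\<SS> x i j k. \<SS> \<in> \<T> \<Longrightarrow> x \<in> \<SS> \<Longrightarrow>
           \<bar>partial i (partial j (\<lambda>y. f y $ k)) x\<bar> \<le> B \<SS>"
    and "\<And>\<SS> x i j k l. \<SS> \<in> \<T> \<Longrightarrow> x \<in> \<SS> \<Longrightarrow>
           \<bar>partial i (partial j (partial k (\<lambda>y. f y $ l))) x\<bar> \<le> B\<^sub>3 \<SS>"
    and "\<And>\<SS> v. \<SS> \<in> \<T> \<Longrightarrow> v \<in> vertices \<SS> \<Longrightarrow> symmetric_matrix (V v)"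
    and "\<And>\<SS>. \<SS> \<in> \<T> \<Longrightarrow> C \<SS> \<ge> 0"
    and "\<And>\<SS>. \<SS> \<in> \<T> \<Longrightarrow> D \<SS> \<ge> 0"
    and constraint1: "\<And>\<SS> v. \<SS> \<in> \<T> \<Longrightarrow> v \<in> vertices \<SS> \<Longrightarrow> mat \<epsilon>\<^sub>0 \<preceq>\<^sub>L V v"
    and constraint2: "\<And>\<SS> v. \<SS> \<in> \<T> \<Longrightarrow> v \<in> vertices \<SS> \<Longrightarrow> V v \<preceq>\<^sub>L mat (C \<SS>)"
    and constraint3: "\<And>\<SS> i j. \<SS> \<in> \<T> \<Longrightarrow> norm1 (cpa_gradient \<T> V \<SS> i j) \<le> D \<SS>"
    and constraint4: "\<And>\<SS> v. \<SS> \<in> \<T> \<Longrightarrow> v \<in> vertices \<SS> \<Longrightarrow>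
           A_mat f \<T> V \<SS> v
             + mat ((diameter \<SS>)\<^sup>2 * E_const CARD('n) (B \<SS>) (B\<^sub>3 \<SS>) (C \<SS>) (D \<SS>))
           \<preceq>\<^sub>L mat (- \<epsilon>\<^sub>0)"
  shows "riemannian_metric (interior (\<Union>\<T>)) (cpa_matrix \<T> V) \<and>
         (\<forall>K. compact K \<and> K \<subseteq> interior (\<Union>\<T>) \<longrightarrow>
            (\<exists>\<nu>>0. contracting_in f S (cpa_matrix \<T> V) K \<nu>))"
proof -
  note T = assms(3) and eps = assms(4)
  let ?G = "interior (\<Union>\<T>)" and ?P = "cpa_matrix \<T> V"
  obtain L where lip: "\<And>U. convex U \<Longrightarrow> U \<subseteq> \<Union>\<T> \<Longrightarrow> L-lipschitz_on U ?P"
    using cpa_matrix_lipschitz[OF T constraint3] by blast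
  have ge: "\<epsilon>\<^sub>0 * (norm u)\<^sup>2 \<le> u \<bullet> (?P x *v u)" if "\<SS> \<in> \<T>" "x \<in> \<SS>" for \<SS> x u
    by (rule cpa_matrix_form_ge[OF T that constraint1[OF that(1)]])
  have sym: "symmetric_matrix (?P x)" if "\<SS> \<in> \<T>" "x \<in> \<SS>" for \<SS> x
    by (rule cpa_matrix_symmetric[OF T that assms(7)[OF that(1)]])
  have pos: "positive_definite (?P x)" if "\<SS> \<in> \<T>" "x \<in> \<SS>" for \<SS> x
    unfolding positive_definite_def
  proof (intro allI impI)
    fix v :: "real ^ 'n" assume "v \<noteq> 0"
    then have "0 < \<epsilon>\<^sub>0 * (norm v)\<^sup>2" using eps by simp
    also have "\<dots> \<le> v \<bullet> (?P x *v v)" using ge[OF that] .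
    finally show "v \<bullet> (?P x *v v) > 0" .
  qed
  have "locally_lipschitz_on ?G ?P"
    unfolding locally_lipschitz_on_def
  proof
    fix x assume "x \<in> ?G"
    then obtain u where u: "u > 0" "cball x u \<subseteq> \<Union>\<T>"
      unfolding mem_interior_cball by blast
    have "L-lipschitz_on (cball x u \<inter> ?G) ?P"
      using lipschitz_on_subset[OF lip[OF convex_cball u(2)]] by blast
    then show "\<exists>u>0. \<exists>L. L-lipschitz_on (cball x u \<inter> ?G) ?P" using u(1) by blast
  qed
  moreover have "symmetric_matrix (?P x) \<and> positive_definite (?P x)" if "x \<in> ?G" for x
    using sym pos interior_subset that by blast
  ultimately have metric: "riemannian_metric ?G ?P"
    unfolding riemannian_metric_def by blast

  \<comment> \<open>A bound on all \<open>C \<SS>\<close>; the summand 1 keeps it positive, so that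
    it can be divided by.\<close>
  define m where "m = 1 + (\<Sum>\<SS>\<in>\<T>. C \<SS>)"
  have m: "C \<SS> \<le> m" if "\<SS> \<in> \<T>" for \<SS>
    using member_le_sum[OF that _ full_triangulationD(1)[OF T], of C] assms(8) by (simp add: m_def)
  have m0: "m > 0" unfolding m_def using assms(8) by (simp add: add_pos_nonneg sum_nonneg)
  define \<nu> where "\<nu> = \<epsilon>\<^sub>0 / (2 * m)"
  \<comment> \<open>\<open>m\<close> is common to all simplices, so a single exponent works on the
    whole interior and every \<open>K\<close> inherits it. The 2 in \<open>\<nu>\<close> matches the
    factor 1/2 in \<open>contracting_in\<close>.\<close>
  have "contracting_in f S ?P ?G \<nu>"
    unfolding contracting_in_def
  proof
    fix x assume "x \<in> ?G"
    then obtain \<SS> where s: "\<SS> \<in> \<T>" "x \<in> \<SS>"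
      "orbital_derivative S ?P x = (\<chi> i j. cpa_gradient \<T> V \<SS> i j \<bullet> f x)"
      using orbital_derivative_cpa[OF T assms(2) _ lip] by blast
    have le: "u \<bullet> (?P x *v u) \<le> C \<SS> * (norm u)\<^sup>2" for u
      by (rule cpa_matrix_form_le[OF T s(1,2) constraint2[OF s(1)]])
    have "u \<bullet> (?P x *v u) \<ge> 0" for u
      by (rule order_trans[OF _ ge[OF s(1,2)]]) (use eps in simp)
    \<comment> \<open>Bounding the entries by \<open>C \<SS>\<close> of the same simplex makes
      \<open>E_const\<close> agree exactly with constraint 4.\<close>
    then have entries: "\<bar>?P x $ i $ j\<bar> \<le> C \<SS>" for i j
      by (rule symmetric_entry_bound[OF sym[OF s(1,2)] _ le])
    have A: "?P x ** Jac f x + transpose (Jac f x) ** ?P x + orbital_derivative S ?P x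
        = A_cpa f \<T> V \<SS> x"
      by (simp add: s(3) A_cpa_def)
    have form: "u \<bullet> (A_cpa f \<T> V \<SS> x *v u) \<le> - \<epsilon>\<^sub>0 * (norm u)\<^sup>2" for u
      by (rule A_cpa_form_le[OF assms(1) T s(1,2) assms(5)[OF s(1)] assms(6)[OF s(1)] entries
            constraint3[OF s(1)] constraint4[OF s(1)]])
    show "(SUP v \<in> {v. v \<bullet> (?P x *v v) = 1}.
           1/2 * (v \<bullet> ((?P x ** Jac f x + transpose (Jac f x) ** ?P x
                          + orbital_derivative S ?P x) *v v))) \<le> - \<nu>"
      unfolding A
    proof (rule cSUP_least)
      \<comment> \<open>The supremum of reals needs a nonempty index set; rescaling any basis vector
        by its positive form value gives a member.\<close>
      define e :: "real ^ 'n" where "e = axis undefined 1"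
      define q where "q = e \<bullet> (?P x *v e)"
      have "e \<noteq> 0" by (simp add: e_def axis_eq_0_iff)
      then have "q > 0"
        using pos[OF s(1,2)] unfolding positive_definite_def q_def by blast
      then have "((1 / sqrt q) *\<^sub>R e) \<bullet> (?P x *v ((1 / sqrt q) *\<^sub>R e)) = 1"
        by (simp add: matrix_vector_mult_scaleR flip: q_def)
      then show "{v. v \<bullet> (?P x *v v) = 1} \<noteq> {}" by blast
    next
      fix v assume "v \<in> {v. v \<bullet> (?P x *v v) = 1}"
      then have "1 \<le> C \<SS> * (norm v)\<^sup>2" using le[of v] by simp
      also have "\<dots> \<le> m * (norm v)\<^sup>2" by (rule mult_right_mono[OF m[OF s(1)]]) simp
      finally have "\<epsilon>\<^sub>0 / m \<le> \<epsilon>\<^sub>0 * (norm v)\<^sup>2"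
        using eps m0 by (simp add: field_simps)
      then show "1/2 * (v \<bullet> (A_cpa f \<T> V \<SS> x *v v)) \<le> - \<nu>"
        using form[of v] by (simp add: \<nu>_def)
    qed
  qed
  then have "contracting_in f S ?P K \<nu>" if "K \<subseteq> ?G" for K
    using that unfolding contracting_in_def by blast
  moreover have "\<nu> > 0" using eps m0 by (simp add: \<nu>_def)
  ultimately show ?thesis using metric by blast
qed

end
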